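(* Let $G$ be a locally compact group with identity $e$, equipped with a left-invariant Haar measure $\mu_G$, and let $(\{A_g\}_{g\in G},\{\Psi_g\}_{g\in G})$ be a Parseval continuous operator-valued frame in $\mathcal{B}(\mathcal{H},\mathcal{H}_0)$ (indexed by the measure space $(G,\mu_G)$). Then there is a unitary representation $\pi$ of $G$ on $\mathcal{H}$ for which $$A_g=A_e\pi_{g^{-1}},\quad \Psi_g=\Psi_e\pi_{g^{-1}},\qquad \forall g\in G,$$ if and only if $$A_{gp}A_{gq}^*=A_pA_q^*,\quad A_{gp}\Psi_{gq}^*=A_p\Psi_q^*,\quad \Psi_{gp}\Psi_{gq}^*=\Psi_p\Psi_q^*,\qquad \forall g,p,q\in G.$$
   Context: $\mathcal{H},\mathcal{H}_0$ are Hilbert spaces over $\mathbb{K}\in\{\mathbb{R},\mathbb{C}\}$, and $\mathcal{B}(\mathcal{H},\mathcal{H}_0)$ is the space of bounded linear operators. All vector-valued integrals are weak: $\int_\Omega F\,d\mu$ is the element of $\mathcal{H}$ with $\langle\int_\Omega F\,d\mu,g\rangle=\int_\Omega\langle F(\alpha),g\rangle\,d\mu(\alpha)$ for all $g\in\mathcal{H}$. Let $(\Omega,\mu)$ be a measure space with positive measure. A collection $\{A_\alpha\}_{\alpha\in\Omega}$ in $\mathcal{B}(\mathcal{H},\mathcal{H}_0)$ is a continuous operator-valued frame with respect to $\{\Psi_\alpha\}_{\alpha\in\Omega}$ in $\mathcal{B}(\mathcal{H},\mathcal{H}_0)$ (one says $(\{A_\alpha\}_{\alpha\in\Omega},\{\Psi_\alpha\}_{\alpha\in\Omega})$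 is a continuous operator-valued frame) if: (i) for each $h\in\mathcal{H}$ the maps $\alpha\mapsto A_\alpha h$ and $\alpha\mapsto\Psi_\alpha h$ from $\Omega$ to $\mathcal{H}_0$ are measurable; (ii) the frame operator $S_{A,\Psi}:\mathcal{H}\ni h\mapsto\int_\Omega\Psi_\alpha^*A_\alpha h\,d\mu(\alpha)\in\mathcal{H}$ is a well-defined bounded positive invertible operator; (iii) the analysis operators $\theta_A,\theta_\Psi:\mathcal{H}\to\mathcal{L}^2(\Omega,\mathcal{H}_0)$, $(\theta_Ah)(\alpha)=A_\alpha h$, $(\theta_\Psi h)(\alpha)=\Psi_\alpha h$, are well-defined bounded linear operators. It is Parseval if $S_{A,\Psi}=I_{\mathcal{H}}$. Here $\Omega=G$ and $\mu=\mu_G$. A unitary representation $\pi$ of $G$ on $\mathcal{H}$ is a homomorphism $g\mapsto\pi_g$ from $G$ to the unitary operators on $\mathcal{H}$ such that $g\mapsto\pi_gh$ is continuous for every $h\in\mathcal{H}$. *)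

theory Defs
  imports "HOL-Analysis.Analysis"
begin

section \<open>The scalar field\<close>

text \<open>
  The last axiom makes the field (a copy of) either the reals or the complex numbers. The
  superclasses banach and second_countable_topology hold for both; they are what the library
  requires of the codomain of a Bochner integral.
\<close>

class real_or_complex = real_normed_field + banach + second_countable_topology +
  fixes to_complex :: "'a \<Rightarrow> complex"
    and conj :: "'a \<Rightarrow> 'a"
  assumes to_complex_add: "to_complex (a + b) = to_complex a + to_complex b"
    and to_complex_mult: "to_complex (a * b) = to_complex a * to_complex b"
    and to_complex_scaleR: "to_complex (r *\<^sub>R a) = r *\<^sub>R to_complex a"
    and norm_to_complex: "norm (to_complex a) = norm a"
    and to_complex_conj: "to_complex (conj a) = cnj (to_complex a)"
    and range_to_complex: "range to_complex = \<real> \<or> range to_complex = UNIV"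

instantiation real :: real_or_complex
begin

definition to_complex_real :: "real \<Rightarrow> complex" where "to_complex_real = of_real"
definition conj_real :: "real \<Rightarrow> real" where "conj_real r = r"

instance
  by standard (auto simp: to_complex_real_def conj_real_def scaleR_conv_of_real Reals_def)

end

instantiation complex :: real_or_complex
begin

definition to_complex_complex :: "complex \<Rightarrow> complex" where "to_complex_complex z = z"
definition conj_complex :: "complex \<Rightarrow> complex" where "conj_complex = cnj"

instance
  by standard (auto simp: to_complex_complex_def conj_complex_def)

end

section \<open>Hilbert spaces and bounded operators\<close>

text \<open>
  The topology, the norm and completeness of a Hilbert space are those of the class banach of its
  carrier type; the axioms tie the norm and the real scalar multiplication of that class to the
  inner product and the scalar multiplication. The inner product is linear in its first argument.
  Since 'h is arbitrary, no separability is assumed and the zero space is allowed.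
\<close>

locale hilbert_space = vector_space scale
  for scale :: "'k::real_or_complex \<Rightarrow> 'h::banach \<Rightarrow> 'h" +
  fixes ip :: "'h \<Rightarrow> 'h \<Rightarrow> 'k"
  assumes scale_of_real: "scale (of_real r) x = r *\<^sub>R x"
    and ip_add_left: "ip (x + y) z = ip x z + ip y z"
    and ip_scale_left: "ip (scale c x) y = c * ip x y"
    and ip_conj_sym: "ip y x = conj (ip x y)"
    and ip_self: "ip x x = of_real ((norm x)\<^sup>2)"

definition bounded_operator ::
  "('k::real_or_complex \<Rightarrow> 'h::banach \<Rightarrow> 'h) \<Rightarrow> ('k \<Rightarrow> 'l::banach \<Rightarrow> 'l) \<Rightarrow> ('h \<Rightarrow> 'l) \<Rightarrow> bool" where
  "bounded_operator s t T \<longleftrightarrow>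
     Vector_Spaces.linear s t T \<and> (\<exists>C. \<forall>x. norm (T x) \<le> C * norm x)"

text \<open>
  Same definition as the library's real constant adjoint; for a bounded operator between Hilbert
  spaces the defining property has exactly one solution.
\<close>

definition hadjoint ::
  "('h \<Rightarrow> 'h \<Rightarrow> 'k::real_or_complex) \<Rightarrow> ('l \<Rightarrow> 'l \<Rightarrow> 'k) \<Rightarrow> ('h \<Rightarrow> 'l) \<Rightarrow> 'l \<Rightarrow> 'h" where
  "hadjoint ip jp T = (SOME T'. \<forall>x y. jp (T x) y = ip x (T' y))"

definition unitary_operator ::
  "('k::real_or_complex \<Rightarrow> 'h::banach \<Rightarrow> 'h) \<Rightarrow> ('h \<Rightarrow> 'h \<Rightarrow> 'k) \<Rightarrow> ('h \<Rightarrow> 'h) \<Rightarrow> bool" where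
  "unitary_operator s ip U \<longleftrightarrow>
     bounded_operator s s U \<and> hadjoint ip ip U \<circ> U = id \<and> U \<circ> hadjoint ip ip U = id"

definition positive_operator ::
  "('k::real_or_complex \<Rightarrow> 'h::banach \<Rightarrow> 'h) \<Rightarrow> ('h \<Rightarrow> 'h \<Rightarrow> 'k) \<Rightarrow> ('h \<Rightarrow> 'h) \<Rightarrow> bool" where
  "positive_operator s ip T \<longleftrightarrow>
     bounded_operator s s T \<and> (\<forall>x y. ip (T x) y = ip x (T y)) \<and>
     (\<forall>x. \<exists>r\<ge>0. ip (T x) x = of_real r)"

definition invertible_operator ::
  "('k::real_or_complex \<Rightarrow> 'h::banach \<Rightarrow> 'h) \<Rightarrow> ('h \<Rightarrow> 'h) \<Rightarrow> bool" where
  "invertible_operator s T \<longleftrightarrow>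
     bounded_operator s s T \<and> (\<exists>R. bounded_operator s s R \<and> R \<circ> T = id \<and> T \<circ> R = id)"

section \<open>Vector-valued functions on a measure space\<close>

definition has_weak_integral ::
  "('h \<Rightarrow> 'h \<Rightarrow> 'k::real_or_complex) \<Rightarrow> 'a measure \<Rightarrow> ('a \<Rightarrow> 'h) \<Rightarrow> 'h \<Rightarrow> bool" where
  "has_weak_integral ip M F y \<longleftrightarrow>
     (\<forall>g. integrable M (\<lambda>\<alpha>. ip (F \<alpha>) g) \<and> ip y g = (\<integral>\<alpha>. ip (F \<alpha>) g \<partial>M))"

definition weak_integral ::
  "('h \<Rightarrow> 'h \<Rightarrow> 'k::real_or_complex) \<Rightarrow> 'a measure \<Rightarrow> ('a \<Rightarrow> 'h) \<Rightarrow> 'h" where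
  "weak_integral ip M F = (THE y. has_weak_integral ip M F y)"

text \<open>
  The Bochner-Lebesgue space of square-integrable functions, at the level of representatives.
  Without strong measurability (being an almost everywhere limit of simple functions) it would not
  be a vector space for general nonseparable targets; for separable targets strong measurability
  follows from Borel measurability.
\<close>

definition L2_functions :: "'a measure \<Rightarrow> ('a \<Rightarrow> 'l::banach) set" where
  "L2_functions M =
     {f. f \<in> borel_measurable M \<and>
         (\<exists>s. (\<forall>i::nat. simple_function M (s i)) \<and> (AE x in M. (\<lambda>i. s i x) \<longlonglongrightarrow> f x)) \<and>
         integrable M (\<lambda>x. (norm (f x))\<^sup>2)}"

definition L2_norm_of :: "'a measure \<Rightarrow> ('a \<Rightarrow> 'l::banach) \<Rightarrow> real" where
  "L2_norm_of M f = sqrt (\<integral>x. (norm (f x))\<^sup>2 \<partial>M)"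

section \<open>Continuous operator-valued frames\<close>

definition analysis_operator :: "('a \<Rightarrow> 'h \<Rightarrow> 'l) \<Rightarrow> 'h \<Rightarrow> 'a \<Rightarrow> 'l" where
  "analysis_operator A h = (\<lambda>\<alpha>. A \<alpha> h)"

definition bounded_into_L2 ::
  "('k::real_or_complex \<Rightarrow> 'h::banach \<Rightarrow> 'h) \<Rightarrow> ('k \<Rightarrow> 'l::banach \<Rightarrow> 'l) \<Rightarrow> 'a measure \<Rightarrow>
   ('h \<Rightarrow> 'a \<Rightarrow> 'l) \<Rightarrow> bool" where
  "bounded_into_L2 s t M \<theta> \<longleftrightarrow>
     (\<forall>h. \<theta> h \<in> L2_functions M) \<and>
     (\<forall>h k. AE \<alpha> in M. \<theta> (h + k) \<alpha> = \<theta> h \<alpha> + \<theta> k \<alpha>) \<and>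
     (\<forall>c h. AE \<alpha> in M. \<theta> (s c h) \<alpha> = t c (\<theta> h \<alpha>)) \<and>
     (\<exists>C. \<forall>h. L2_norm_of M (\<theta> h) \<le> C * norm h)"

definition frame_operator ::
  "('h \<Rightarrow> 'h \<Rightarrow> 'k::real_or_complex) \<Rightarrow> ('l \<Rightarrow> 'l \<Rightarrow> 'k) \<Rightarrow> 'a measure \<Rightarrow>
   ('a \<Rightarrow> 'h \<Rightarrow> 'l) \<Rightarrow> ('a \<Rightarrow> 'h \<Rightarrow> 'l) \<Rightarrow> 'h \<Rightarrow> 'h" where
  "frame_operator ip jp M A \<Psi> h = weak_integral ip M (\<lambda>\<alpha>. hadjoint ip jp (\<Psi> \<alpha>) (A \<alpha> h))"

text \<open>
  The existence of the weak integral is required separately because weak_integral is total.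
\<close>

definition continuous_ov_frame ::
  "('k::real_or_complex \<Rightarrow> 'h::banach \<Rightarrow> 'h) \<Rightarrow> ('h \<Rightarrow> 'h \<Rightarrow> 'k) \<Rightarrow>
   ('k \<Rightarrow> 'l::banach \<Rightarrow> 'l) \<Rightarrow> ('l \<Rightarrow> 'l \<Rightarrow> 'k) \<Rightarrow> 'a measure \<Rightarrow>
   ('a \<Rightarrow> 'h \<Rightarrow> 'l) \<Rightarrow> ('a \<Rightarrow> 'h \<Rightarrow> 'l) \<Rightarrow> bool" where
  "continuous_ov_frame s ip t jp M A \<Psi> \<longleftrightarrow>
     (\<forall>\<alpha>\<in>space M. bounded_operator s t (A \<alpha>) \<and> bounded_operator s t (\<Psi> \<alpha>)) \<and>
     (\<forall>h. (\<lambda>\<alpha>. A \<alpha> h) \<in> borel_measurable M \<and> (\<lambda>\<alpha>. \<Psi> \<alpha> h) \<in> borel_measurable M) \<and>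
     (\<forall>h. \<exists>y. has_weak_integral ip M (\<lambda>\<alpha>. hadjoint ip jp (\<Psi> \<alpha>) (A \<alpha> h)) y) \<and>
     positive_operator s ip (frame_operator ip jp M A \<Psi>) \<and>
     invertible_operator s (frame_operator ip jp M A \<Psi>) \<and>
     bounded_into_L2 s t M (analysis_operator A) \<and>
     bounded_into_L2 s t M (analysis_operator \<Psi>)"

definition parseval_ov_frame ::
  "('k::real_or_complex \<Rightarrow> 'h::banach \<Rightarrow> 'h) \<Rightarrow> ('h \<Rightarrow> 'h \<Rightarrow> 'k) \<Rightarrow>
   ('k \<Rightarrow> 'l::banach \<Rightarrow> 'l) \<Rightarrow> ('l \<Rightarrow> 'l \<Rightarrow> 'k) \<Rightarrow> 'a measure \<Rightarrow>
   ('a \<Rightarrow> 'h \<Rightarrow> 'l) \<Rightarrow> ('a \<Rightarrow> 'h \<Rightarrow> 'l) \<Rightarrow> bool" where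
  "parseval_ov_frame s ip t jp M A \<Psi> \<longleftrightarrow>
     continuous_ov_frame s ip t jp M A \<Psi> \<and> frame_operator ip jp M A \<Psi> = id"

section \<open>Haar measure and unitary representations\<close>

text \<open>
  Groups are written additively because the library's class of topological groups is
  topological_group_add, which does not assume commutativity: the group product, the inverse and
  the identity are +, unary minus and 0. Locally compact groups are Hausdorff.
  A Haar measure is a nonzero left-invariant Radon measure on the Borel sets: finite on compact
  sets, outer regular on Borel sets, and inner regular on open sets.
\<close>

definition left_haar_measure :: "'g::{topological_group_add, t2_space} measure \<Rightarrow> bool" where
  "left_haar_measure M \<longleftrightarrow>
     sets M = sets borel \<and>
     (\<forall>K. compact K \<longrightarrow> emeasure M K < \<infinity>) \<and>
     (\<forall>E\<in>sets borel. emeasure M E = (INF U\<in>{U. open U \<and> E \<subseteq> U}. emeasure M U)) \<and>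
     (\<forall>U. open U \<longrightarrow> emeasure M U = (SUP K\<in>{K. compact K \<and> K \<subseteq> U}. emeasure M K)) \<and>
     (\<forall>g. \<forall>E\<in>sets borel. emeasure M ((+) g ` E) = emeasure M E) \<and>
     emeasure M UNIV \<noteq> 0"

definition unitary_representation ::
  "('k::real_or_complex \<Rightarrow> 'h::banach \<Rightarrow> 'h) \<Rightarrow> ('h \<Rightarrow> 'h \<Rightarrow> 'k) \<Rightarrow>
   ('g::topological_group_add \<Rightarrow> 'h \<Rightarrow> 'h) \<Rightarrow> bool" where
  "unitary_representation s ip \<pi> \<longleftrightarrow>
     (\<forall>g. unitary_operator s ip (\<pi> g)) \<and>
     (\<forall>g p. \<pi> (g + p) = \<pi> g \<circ> \<pi> p) \<and>
     (\<forall>h. continuous_on UNIV (\<lambda>g. \<pi> g h))"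

end

theory Submission
  imports Defs
begin

text \<open>
  If the invariance relations hold, then for each g the vectors \<open>A\<^sub>p\<^sup>* y\<close> and \<open>A\<^sub>g\<^sub>p\<^sup>* y\<close> have the same Gram
  matrix. By the Parseval property, these vectors are total: a vector orthogonal to all of them is
  annihilated by every \<open>A\<^sub>p\<close>, hence by the frame operator. So there is a unique unitary \<open>\<pi>\<^sub>g\<close> with
  \<open>\<pi>\<^sub>g A\<^sub>p\<^sup>* y = A\<^sub>g\<^sub>p\<^sup>* y\<close>. Uniqueness makes \<open>\<pi>\<close> a homomorphism, and the mixed relation yields
  \<open>\<pi>\<^sub>g \<Psi>\<^sub>p\<^sup>* y = \<Psi>\<^sub>g\<^sub>p\<^sup>* y\<close>; taking adjoints gives the two factorisations. Strong continuity is inherited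
  from the left regular representation: the analysis operator of A intertwines \<open>\<pi>\<close> with it and, by
  the Parseval property, is bounded below.
\<close>

section \<open>Scalars and Hilbert spaces\<close>

lemma to_complex_diff:
  fixes a b :: "'k::real_or_complex"
  shows "to_complex (a - b) = to_complex a - to_complex b"
  by (metis add_diff_cancel diff_add_cancel to_complex_add)

text \<open>An additive isometry has trivial kernel. Identities for \<open>conj\<close> can
  therefore be checked after embedding into the complex numbers.\<close>

lemma inj_to_complex: "inj (to_complex :: 'k::real_or_complex \<Rightarrow> complex)"
proof (rule injI)
  fix a b :: 'k assume "to_complex a = to_complex b"
  then have "norm (a - b) = 0"
    by (metis norm_to_complex to_complex_diff diff_self norm_zero)
  then show "a = b" by simp
qed

text \<open>The image of 1 is idempotent, hence 0 or 1, and norm preservation excludes 0.\<close>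

lemma to_complex_1: "to_complex (1 :: 'k::real_or_complex) = 1"
proof -
  have "to_complex (1::'k) * to_complex (1::'k) = to_complex (1::'k)"
    by (metis to_complex_mult mult_1)
  moreover have "to_complex (1::'k) \<noteq> 0"
    by (metis norm_to_complex norm_one norm_zero zero_neq_one)
  ultimately show ?thesis by simp
qed

lemma to_complex_of_real: "to_complex (of_real r :: 'k::real_or_complex) = of_real r"
  by (simp add: of_real_def to_complex_scaleR to_complex_1)

lemma conj_add: "conj (a + b) = conj a + conj (b :: 'k::real_or_complex)"
  by (rule injD[OF inj_to_complex]) (simp add: to_complex_add to_complex_conj)

lemma conj_mult: "conj (a * b) = conj a * conj (b :: 'k::real_or_complex)"
  by (rule injD[OF inj_to_complex]) (simp add: to_complex_mult to_complex_conj)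

lemma conj_conj: "conj (conj a) = (a :: 'k::real_or_complex)"
  by (rule injD[OF inj_to_complex]) (simp add: to_complex_conj)

lemma conj_of_real: "conj (of_real r) = (of_real r :: 'k::real_or_complex)"
  by (rule injD[OF inj_to_complex]) (simp add: to_complex_conj to_complex_of_real)

lemma conj_0: "conj 0 = (0 :: 'k::real_or_complex)"
  using conj_of_real[of 0] by simp

lemma norm_conj: "norm (conj a) = norm (a :: 'k::real_or_complex)"
  by (metis complex_mod_cnj norm_to_complex to_complex_conj)

lemma mult_conj_self: "a * conj a = of_real ((norm (a :: 'k::real_or_complex))\<^sup>2)"
proof (rule injD[OF inj_to_complex])
  show "to_complex (a * conj a) = to_complex (of_real ((norm a)\<^sup>2) :: 'k)"
    unfolding to_complex_mult to_complex_conj to_complex_of_real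
    by (metis complex_norm_square norm_to_complex)
qed

section \<open>Inner product calculus and the Cauchy-Schwarz inequality\<close>

context hilbert_space
begin

lemma ip_add_right: "ip x (y + z) = ip x y + ip x z"
  by (metis ip_conj_sym ip_add_left conj_add)

lemma ip_scale_right: "ip x (scale c y) = conj c * ip x y"
  by (metis ip_conj_sym ip_scale_left conj_mult)

lemma ip_minus_left: "ip (- x) y = - ip x y"
  by (metis scale_minus_left scale_one ip_scale_left mult_minus_left)

lemma ip_zero_left: "ip 0 y = 0"
  by (metis add_cancel_right_right ip_add_left)

lemma ip_zero_right: "ip x 0 = 0"
  by (metis ip_conj_sym ip_zero_left conj_0)

lemma ip_minus_right: "ip x (- y) = - ip x y"
  using ip_add_right[of x y "- y"] by (simp add: ip_zero_right eq_neg_iff_add_eq_0 add.commute)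

lemma ip_diff_left: "ip (x - y) z = ip x z - ip y z"
  by (metis diff_conv_add_uminus ip_add_left ip_minus_left)

lemma ip_diff_right: "ip x (y - z) = ip x y - ip x z"
  by (metis diff_conv_add_uminus ip_add_right ip_minus_right)

lemma ip_left_eqI: "(\<And>y. ip x y = ip x' y) \<Longrightarrow> x = x'"
  using ip_self[of "x - x'"] by (simp add: ip_diff_left)

lemma ip_right_eqI: "(\<And>x. ip x y = ip x y') \<Longrightarrow> y = y'"
  by (metis ip_conj_sym ip_left_eqI)

lemma norm_scale: "norm (scale c x) = norm c * norm x"
proof -
  have "(of_real ((norm (scale c x))\<^sup>2) :: 'k) = (c * conj c) * ip x x"
    by (metis ip_self ip_scale_left ip_scale_right mult.assoc)
  also have "\<dots> = of_real ((norm c * norm x)\<^sup>2)"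
    by (simp add: mult_conj_self ip_self power_mult_distrib)
  finally have "(norm (scale c x))\<^sup>2 = (norm c * norm x)\<^sup>2"
    by (simp only: of_real_eq_iff)
  then show ?thesis by simp
qed

text \<open>Pythagoras: the residual is orthogonal to \<open>y\<close>. Nonnegativity of the left
  side yields Cauchy-Schwarz; minimality of a distance makes the subtracted term vanish.\<close>

lemma norm_diff_projection:
  assumes "y \<noteq> 0"
  shows "(norm (x - scale (ip x y / of_real ((norm y)\<^sup>2)) y))\<^sup>2
           = (norm x)\<^sup>2 - (norm (ip x y))\<^sup>2 / (norm y)\<^sup>2"
proof -
  define n :: 'k where "n = of_real ((norm y)\<^sup>2)"
  define c where "c = ip x y / n"
  have n0: "n \<noteq> 0" using assms by (simp add: n_def)
  have cy: "ip (x - scale c y) y = 0"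
    using n0 by (simp add: ip_diff_left ip_scale_left ip_self n_def[symmetric] c_def
        del: of_real_power)
  have "(of_real ((norm (x - scale c y))\<^sup>2) :: 'k) = ip (x - scale c y) (x - scale c y)"
    by (simp add: ip_self)
  also have "\<dots> = ip (x - scale c y) x"
    by (simp add: ip_diff_right[of "x - scale c y" x] ip_scale_right cy)
  also have "\<dots> = ip x x - c * conj (ip x y)"
    by (simp add: ip_diff_left ip_scale_left ip_conj_sym[symmetric])
  also have "\<dots> = of_real ((norm x)\<^sup>2 - (norm (ip x y))\<^sup>2 / (norm y)\<^sup>2)"
    by (simp add: ip_self c_def n_def mult_conj_self)
  finally show ?thesis
    by (simp only: of_real_eq_iff c_def n_def)
qed

lemma Cauchy_Schwarz_ip: "norm (ip x y) \<le> norm x * norm y"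
proof (cases "y = 0")
  case False
  have "0 \<le> (norm x)\<^sup>2 - (norm (ip x y))\<^sup>2 / (norm y)\<^sup>2"
    by (metis norm_diff_projection[OF False] zero_le_power2)
  then have "(norm (ip x y))\<^sup>2 \<le> (norm x * norm y)\<^sup>2"
    using False by (simp add: divide_simps)
  then show ?thesis by (rule power2_le_imp_le) simp
qed (simp add: ip_zero_right)

lemma tendsto_ip:
  assumes "(f \<longlongrightarrow> x) F" "(g \<longlongrightarrow> y) F"
  shows "((\<lambda>n. ip (f n) (g n)) \<longlongrightarrow> ip x y) F"
proof (rule LIM_zero_cancel, rule Lim_null_comparison)
  show "\<forall>\<^sub>F n in F. norm (ip (f n) (g n) - ip x y)
          \<le> norm (f n - x) * norm (g n) + norm x * norm (g n - y)"
  proof (rule always_eventually, rule allI)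
    fix n
    have "ip (f n) (g n) - ip x y = ip (f n - x) (g n) + ip x (g n - y)"
      by (simp add: ip_diff_left ip_diff_right)
    then show "norm (ip (f n) (g n) - ip x y)
          \<le> norm (f n - x) * norm (g n) + norm x * norm (g n - y)"
      by (simp only:) (intro norm_triangle_le add_mono Cauchy_Schwarz_ip)
  qed
  have "((\<lambda>n. norm (f n - x) * norm (g n) + norm x * norm (g n - y)) \<longlongrightarrow>
          norm (x - x) * norm y + norm x * norm (y - y)) F"
    by (intro tendsto_intros assms)
  then show "((\<lambda>n. norm (f n - x) * norm (g n) + norm x * norm (g n - y)) \<longlongrightarrow> 0) F"
    by simp
qed

lemma tendsto_scale: "(f \<longlongrightarrow> x) F \<Longrightarrow> ((\<lambda>n. scale c (f n)) \<longlongrightarrow> scale c x) F"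
proof (rule LIM_zero_cancel, rule Lim_null_comparison)
  assume f: "(f \<longlongrightarrow> x) F"
  show "\<forall>\<^sub>F n in F. norm (scale c (f n) - scale c x) \<le> norm c * norm (f n - x)"
    by (intro always_eventually allI) (metis norm_scale order_refl scale_right_diff_distrib)
  show "((\<lambda>n. norm c * norm (f n - x)) \<longlongrightarrow> 0) F"
    using f by (auto intro!: tendsto_eq_intros)
qed

section \<open>Nearest points, orthogonal decomposition and Riesz representation\<close>

lemma parallelogram:
  fixes x y :: 'h
  shows "(norm (x + y))\<^sup>2 + (norm (x - y))\<^sup>2 = 2 * (norm x)\<^sup>2 + 2 * (norm y)\<^sup>2"
proof -
  have "(of_real ((norm (x + y))\<^sup>2 + (norm (x - y))\<^sup>2) :: 'k)
          = of_real (2 * (norm x)\<^sup>2 + 2 * (norm y)\<^sup>2)"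
    unfolding of_real_add of_real_mult ip_self[symmetric]
    by (simp add: ip_add_left ip_add_right ip_diff_left ip_diff_right)
  then show ?thesis by (simp only: of_real_eq_iff)
qed

text \<open>A norm-minimising sequence is Cauchy by the parallelogram law, because midpoints stay in
  \<open>C\<close> and cannot beat the infimum \<open>d\<close>. Completeness and closedness place
  its limit in \<open>C\<close>.\<close>

lemma min_norm_exists:
  fixes C :: "'h set"
  assumes "closed C" "C \<noteq> {}" and mid: "\<And>x y. x \<in> C \<Longrightarrow> y \<in> C \<Longrightarrow> (1/2) *\<^sub>R (x + y) \<in> C"
  shows "\<exists>z\<in>C. \<forall>x\<in>C. norm z \<le> norm x"
proof -
  define d where "d = (INF x\<in>C. (norm x)\<^sup>2)"
  have bdd: "bdd_below ((\<lambda>x. (norm x)\<^sup>2) ` C)" by (rule bdd_belowI[of _ 0]) auto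
  have d_le: "d \<le> (norm x)\<^sup>2" if "x \<in> C" for x
    unfolding d_def using bdd that by (rule cINF_lower)
  have "\<exists>x\<in>C. (norm x)\<^sup>2 < d + 1 / real (Suc n)" for n
  proof -
    have "(INF x\<in>C. (norm x)\<^sup>2) < d + 1 / real (Suc n)" unfolding d_def[symmetric] by simp
    then show ?thesis using cINF_less_iff[OF assms(2) bdd] by blast
  qed
  then obtain X where X: "\<And>n. X n \<in> C" "\<And>n. (norm (X n))\<^sup>2 < d + 1 / real (Suc n)"
    by metis
  have diff: "(norm (X m - X n))\<^sup>2 \<le> 2 / real (Suc m) + 2 / real (Suc n)" for m n
  proof -
    have "d \<le> (norm ((1/2) *\<^sub>R (X m + X n)))\<^sup>2" by (intro d_le mid X)
    then have "4 * d \<le> (norm (X m + X n))\<^sup>2" by (simp add: power_divide)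
    then show ?thesis using parallelogram[of "X m" "X n"] X(2)[of m] X(2)[of n] by simp
  qed
  have "Cauchy X"
  proof (rule CauchyI)
    fix e :: real assume "0 < e"
    obtain N where N: "inverse (real (Suc N)) < e\<^sup>2 / 4"
      using reals_Archimedean[of "e\<^sup>2 / 4"] \<open>0 < e\<close> by auto
    show "\<exists>M. \<forall>m\<ge>M. \<forall>n\<ge>M. norm (X m - X n) < e"
    proof (intro exI allI impI)
      fix m n assume "N \<le> m" "N \<le> n"
      then have "inverse (real (Suc m)) \<le> inverse (real (Suc N))"
        "inverse (real (Suc n)) \<le> inverse (real (Suc N))"
        by (simp_all)
      then have "(norm (X m - X n))\<^sup>2 < e\<^sup>2"
        using diff[of m n] N unfolding divide_inverse[of 2] by linarith
      then show "norm (X m - X n) < e"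
        using \<open>0 < e\<close> by (simp add: power_less_imp_less_base)
    qed
  qed
  then obtain z where z: "X \<longlonglongrightarrow> z" using Cauchy_convergent convergent_def by blast
  have "z \<in> C" using assms(1) X(1) z by (rule closed_sequentially)
  moreover have "norm z \<le> norm x" if "x \<in> C" for x
  proof -
    have "(\<lambda>n. (norm (X n))\<^sup>2) \<longlonglongrightarrow> (norm z)\<^sup>2" by (intro tendsto_intros z)
    moreover have "(\<lambda>n. d + 1 / real (Suc n)) \<longlonglongrightarrow> d + 0"
      by (intro tendsto_add tendsto_const LIMSEQ_Suc lim_1_over_n)
    ultimately have "(norm z)\<^sup>2 \<le> d + 0"
      by (rule LIMSEQ_le) (use X(2) less_imp_le in blast)
    then show ?thesis using d_le[OF that] by (simp add: power2_le_imp_le)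
  qed
  ultimately show ?thesis by blast
qed

text \<open>The vector of minimal norm in the translate of \<open>S\<close> by \<open>x\<close> is
  orthogonal to \<open>S\<close>.\<close>

lemma orthogonal_component_exists:
  assumes S: "closed S" "0 \<in> S" "\<And>x y. x \<in> S \<Longrightarrow> y \<in> S \<Longrightarrow> x + y \<in> S"
    "\<And>c x. x \<in> S \<Longrightarrow> scale c x \<in> S"
  shows "\<exists>m\<in>S. \<forall>y\<in>S. ip (x - m) y = 0"
proof -
  have neg: "- m \<in> S" if "m \<in> S" for m using S(4)[OF that, of "- 1"] by simp
  have scaleR: "r *\<^sub>R m \<in> S" if "m \<in> S" for r m
    using S(4)[OF that, of "of_real r"] by (simp add: scale_of_real)
  let ?C = "(+) x ` S"
  have "\<exists>z\<in>?C. \<forall>y\<in>?C. norm z \<le> norm y"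
  proof (rule min_norm_exists)
    show "closed ?C" using S(1) by (rule closed_translation)
    show "?C \<noteq> {}" using S(2) by blast
    fix a b assume "a \<in> ?C" "b \<in> ?C"
    then obtain m n where mn: "m \<in> S" "n \<in> S" "a = x + m" "b = x + n" by blast
    have "(1/2) *\<^sub>R (a + b) = x + (1/2) *\<^sub>R (m + n)"
      using scaleR_half_double[of x] by (simp add: mn algebra_simps)
    then show "(1/2) *\<^sub>R (a + b) \<in> ?C" using mn S(3) scaleR by blast
  qed
  then obtain m where m: "m \<in> S" and min: "\<And>n. n \<in> S \<Longrightarrow> norm (x + m) \<le> norm (x + n)"
    by blast
  have "ip (x + m) y = 0" if y: "y \<in> S" for y
  proof (cases "y = 0")
    case False
    \<comment> \<open>Removing the component of \<open>x + m\<close> along \<open>y\<close> stays in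
      the translate of \<open>S\<close>. By minimality this cannot shorten the vector, so by
      \<open>norm_diff_projection\<close> the component is zero.\<close>
    let ?c = "ip (x + m) y / of_real ((norm y)\<^sup>2)"
    have "norm (x + m) \<le> norm (x + (m + - scale ?c y))"
      by (intro min S(3) neg S(4) m y)
    then have "(norm (x + m))\<^sup>2 \<le> (norm (x + m - scale ?c y))\<^sup>2"
      by (intro power_mono) (simp_all add: add_diff_eq)
    then have "(norm (ip (x + m) y))\<^sup>2 / (norm y)\<^sup>2 \<le> 0"
      unfolding norm_diff_projection[OF False] by linarith
    then show ?thesis using False by (simp add: divide_le_0_iff)
  qed (simp add: ip_zero_right)
  \<comment> \<open>The minimiser has the form \<open>x + m\<close>, so the required element of
    \<open>S\<close> is \<open>- m\<close>.\<close>
  then show ?thesis using m neg by (intro bexI[of _ "- m"]) auto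
qed

text \<open>A nonzero \<open>f\<close> has a closed kernel. The component orthogonal to this kernel
  of some \<open>a\<close> with \<open>f a\<close> nonzero represents \<open>f\<close> after
  rescaling.\<close>

lemma Riesz_representation:
  assumes add: "\<And>x y. f (x + y) = f x + f y" and scale: "\<And>c x. f (scale c x) = c * f x"
    and bdd: "\<And>x. norm (f x) \<le> C * norm x"
  shows "\<exists>z. \<forall>x. f x = ip x z"
proof (cases "\<forall>x. f x = 0")
  case True
  then show ?thesis using ip_zero_right by metis
next
  case False
  then obtain a where a: "f a \<noteq> 0" by blast
  let ?S = "{x. f x = 0}"
  have f0: "f 0 = 0" using scale[of 0 0] by simp
  have fdiff: "f (x - y) = f x - f y" for x y
    by (metis add add_diff_cancel diff_add_cancel)
  have "closed ?S"
  proof (unfold closed_sequential_limits, intro allI impI)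
    fix X l assume X: "(\<forall>n. X n \<in> ?S) \<and> X \<longlonglongrightarrow> l"
    have "norm (f l) \<le> C * norm (l - X n)" for n
      using bdd[of "l - X n"] X by (simp add: fdiff)
    moreover have "(\<lambda>n. C * norm (l - X n)) \<longlonglongrightarrow> C * norm (l - l)"
      by (intro tendsto_intros) (use X in blast)
    ultimately have "norm (f l) \<le> C * norm (l - l)"
      by (intro LIMSEQ_le_const) auto
    then show "l \<in> ?S" by simp
  qed
  then have "\<exists>m\<in>?S. \<forall>y\<in>?S. ip (a - m) y = 0"
    by (rule orthogonal_component_exists) (simp_all add: f0 add scale)
  then obtain m where m: "f m = 0" and orth: "\<And>y. f y = 0 \<Longrightarrow> ip (a - m) y = 0" by blast
  define z where "z = a - m"
  define n :: 'k where "n = of_real ((norm z)\<^sup>2)"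
  have fz: "f z = f a" by (simp add: z_def fdiff m)
  then have "z \<noteq> 0" using a f0 by metis
  then have n0: "n \<noteq> 0" by (simp add: n_def)
  \<comment> \<open>The outer conjugate compensates for conjugate-linearity in the second argument.
    The value at \<open>z\<close> fixes the factor, and \<open>x - scale (f x / f z) z\<close> lies
    in the kernel of \<open>f\<close>.\<close>
  have "f x = ip x (scale (conj (f z / n)) z)" for x
  proof -
    have "ip z (x - scale (f x / f z) z) = 0"
      unfolding z_def
      by (rule orth) (use a fz in \<open>simp add: fdiff scale z_def[symmetric]\<close>)
    then have "ip (x - scale (f x / f z) z) z = 0"
      using ip_conj_sym conj_0 by metis
    then have "ip x z = f x / f z * n"
      by (simp add: ip_diff_left ip_scale_left ip_self n_def)
    then show ?thesis using a fz n0 by (simp add: ip_scale_right conj_conj)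
  qed
  then show ?thesis by blast
qed

text \<open>The component of \<open>x\<close> orthogonal to the closure of \<open>S\<close> is
  orthogonal to \<open>S\<close>, hence zero by totality, so \<open>x\<close> lies in the
  closure.\<close>

lemma dense_if_total:
  assumes S: "0 \<in> S" "\<And>x y. x \<in> S \<Longrightarrow> y \<in> S \<Longrightarrow> x + y \<in> S"
    "\<And>c x. x \<in> S \<Longrightarrow> scale c x \<in> S"
    and total: "\<And>x. (\<And>y. y \<in> S \<Longrightarrow> ip x y = 0) \<Longrightarrow> x = 0"
  shows "closure S = UNIV"
proof -
  have "x \<in> closure S" for x
  proof -
    have "\<exists>m\<in>closure S. \<forall>y\<in>closure S. ip (x - m) y = 0"
    proof (rule orthogonal_component_exists)
      show "0 \<in> closure S" using S(1) closure_subset by blast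
      fix a b c assume "a \<in> closure S"
      then obtain X where X: "\<And>n. X n \<in> S" "X \<longlonglongrightarrow> a" by (auto simp: closure_sequential)
      show "scale c a \<in> closure S"
        unfolding closure_sequential using S(3)[OF X(1)] tendsto_scale[OF X(2)]
        by (intro exI[of _ "\<lambda>n. scale c (X n)"]) simp
      assume "b \<in> closure S"
      then obtain Y where Y: "\<And>n. Y n \<in> S" "Y \<longlonglongrightarrow> b" by (auto simp: closure_sequential)
      have "\<And>n. X n + Y n \<in> S" by (intro S(2) X Y)
      then show "a + b \<in> closure S"
        unfolding closure_sequential using tendsto_add[OF X(2) Y(2)]
        by (intro exI[of _ "\<lambda>n. X n + Y n"]) simp
    qed simp
    then show ?thesis
      using total closure_subset by (metis eq_iff_diff_eq_0 subsetD)
  qed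
  then show ?thesis by blast
qed

end

text \<open>For each \<open>y\<close>, Riesz represents the bounded functional sending
  \<open>x\<close> to \<open>ip0 (T x) y\<close>. Collecting the representers over all
  \<open>y\<close> supplies the witness for the \<open>SOME\<close> in
  \<open>hadjoint\<close>.\<close>

lemma hadjoint_eq:
  fixes scale :: "'k::real_or_complex \<Rightarrow> 'h::banach \<Rightarrow> 'h" and ip :: "'h \<Rightarrow> 'h \<Rightarrow> 'k"
    and scale0 :: "'k \<Rightarrow> 'l::banach \<Rightarrow> 'l" and ip0 :: "'l \<Rightarrow> 'l \<Rightarrow> 'k"
  assumes H: "hilbert_space scale ip" and H0: "hilbert_space scale0 ip0"
    and T: "bounded_operator scale scale0 T"
  shows "ip0 (T x) y = ip x (hadjoint ip ip0 T y)"
proof -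
  interpret H: hilbert_space scale ip by (rule H)
  interpret H0: hilbert_space scale0 ip0 by (rule H0)
  have lin: "Vector_Spaces.linear scale scale0 T"
    using T by (simp add: bounded_operator_def)
  interpret T: Vector_Spaces.linear scale scale0 T by (rule lin)
  obtain C where C: "\<And>x. norm (T x) \<le> C * norm x"
    using T by (auto simp: bounded_operator_def)
  have "\<exists>z. \<forall>x. ip0 (T x) y = ip x z" for y
  proof (rule H.Riesz_representation)
    show "norm (ip0 (T x) y) \<le> (C * norm y) * norm x" for x
      using order_trans[OF H0.Cauchy_Schwarz_ip mult_right_mono[OF C norm_ge_zero]]
      by (metis mult.assoc mult.commute)
  qed (simp_all add: T.add T.scale H0.ip_add_left H0.ip_scale_left)
  then have "\<exists>T'. \<forall>x y. ip0 (T x) y = ip x (T' y)" by metis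
  then have "\<forall>x y. ip0 (T x) y = ip x (hadjoint ip ip0 T y)"
    unfolding hadjoint_def by (rule someI_ex)
  then show ?thesis by blast
qed

section \<open>Unitary operators and their construction from equal Gram matrices\<close>

context hilbert_space
begin

text \<open>Preservation of inner products makes the adjoint a left inverse, and surjectivity makes
  this left inverse two-sided.\<close>

lemma unitary_operatorI:
  assumes lin: "Vector_Spaces.linear scale scale U"
    and iso: "\<And>x y. ip (U x) (U y) = ip x y" and surj: "surj U"
  shows "unitary_operator scale ip U"
proof -
  have "(of_real ((norm (U x))\<^sup>2) :: 'k) = of_real ((norm x)\<^sup>2)" for x
    using iso[of x x] by (simp add: ip_self)
  then have "norm (U x) = norm x" for x
    by (simp only: of_real_eq_iff) simp
  then have bdd: "bounded_operator scale scale U"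
    unfolding bounded_operator_def using lin by (intro conjI exI[of _ 1]) simp_all
  let ?U' = "hadjoint ip ip U"
  have left: "?U' (U y) = y" for y
    by (rule ip_right_eqI) (metis hadjoint_eq[OF hilbert_space_axioms hilbert_space_axioms bdd] iso)
  moreover have "U (?U' y) = y" for y
    using surj left by (metis surjD)
  ultimately show ?thesis
    unfolding unitary_operator_def using bdd by (auto simp: fun_eq_iff)
qed

lemma unitary_operator_ip:
  assumes "unitary_operator scale ip U"
  shows "ip (U x) (U y) = ip x y"
proof -
  have "bounded_operator scale scale U" and left: "hadjoint ip ip U (U y) = y"
    using assms by (auto simp: unitary_operator_def fun_eq_iff)
  then show ?thesis
    using hadjoint_eq[OF hilbert_space_axioms hilbert_space_axioms] by metis
qed

lemma unitary_operator_norm: "unitary_operator scale ip U \<Longrightarrow> norm (U x) = norm x"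
  using unitary_operator_ip[of U x x]
  by (metis ip_self of_real_eq_iff norm_ge_zero power2_eq_iff_nonneg)

text \<open>
  The graph of the linear extension of u i \<open>\<mapsto>\<close> v i: a relation, because linear dependencies among
  the u i make single-valuedness a consequence of the equality of the Gram matrices.
\<close>

inductive gram_rel :: "('i \<Rightarrow> 'h) \<Rightarrow> ('i \<Rightarrow> 'h) \<Rightarrow> 'h \<Rightarrow> 'h \<Rightarrow> bool" for u v where
  zero: "gram_rel u v 0 0"
| step: "gram_rel u v x y \<Longrightarrow> gram_rel u v (scale c (u i) + x) (scale c (v i) + y)"

lemma gram_rel_add:
  "gram_rel u v x y \<Longrightarrow> gram_rel u v x' y' \<Longrightarrow> gram_rel u v (x + x') (y + y')"
  by (induction rule: gram_rel.induct) (auto simp: add.assoc intro: gram_rel.step)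

lemma gram_rel_scale: "gram_rel u v x y \<Longrightarrow> gram_rel u v (scale c x) (scale c y)"
  by (induction rule: gram_rel.induct)
    (auto simp: scale_right_distrib intro: gram_rel.intros)

lemma gram_rel_swap: "gram_rel u v x y \<Longrightarrow> gram_rel v u y x"
  by (induction rule: gram_rel.induct) (auto intro: gram_rel.intros)

lemma gram_rel_generator: "gram_rel u v (u i) (v i)"
  using gram_rel.step[OF gram_rel.zero, where c = 1] by simp

text \<open>One induction passes from generators to linear combinations in the first argument, a
  second one in the other argument.\<close>

lemma gram_rel_ip:
  assumes gram: "\<And>i j. ip (u i) (u j) = ip (v i) (v j)"
    and x: "gram_rel u v x y" and x': "gram_rel u v x' y'"
  shows "ip x x' = ip y y'"
proof -
  have gen: "ip x (u j) = ip y (v j)" for j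
    using x by (induction rule: gram_rel.induct)
      (simp_all add: ip_zero_left ip_add_left ip_scale_left gram)
  show ?thesis
    using x' by (induction rule: gram_rel.induct)
      (simp_all add: ip_zero_right ip_add_right ip_scale_right gen)
qed

text \<open>The relation is linear, so the two differences are related as well. This is what carries
  Cauchy sequences to Cauchy sequences.\<close>

lemma gram_rel_norm_diff:
  assumes gram: "\<And>i j. ip (u i) (u j) = ip (v i) (v j)"
    and x: "gram_rel u v x y" and x': "gram_rel u v x' y'"
  shows "norm (x - x') = norm (y - y')"
proof -
  have "gram_rel u v (x - x') (y - y')"
    using gram_rel_add[OF x gram_rel_scale[OF x', of "- 1"]] by simp
  then have "ip (x - x') (x - x') = ip (y - y') (y - y')"
    using gram_rel_ip[of u v, OF gram] by blast
  then have "(norm (x - x'))\<^sup>2 = (norm (y - y'))\<^sup>2"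
    unfolding ip_self by (simp only: of_real_eq_iff)
  then show ?thesis by simp
qed

text \<open>The sequential closure of the graph \<open>gram_rel\<close>. Equal Gram matrices keep it
  single-valued and isometric; if both families are total, it is the graph of the unitary
  extension.\<close>

definition gram_lim :: "('i \<Rightarrow> 'h) \<Rightarrow> ('i \<Rightarrow> 'h) \<Rightarrow> 'h \<Rightarrow> 'h \<Rightarrow> bool" where
  "gram_lim u v x y \<longleftrightarrow>
     (\<exists>X Y. (\<forall>n::nat. gram_rel u v (X n) (Y n)) \<and> X \<longlonglongrightarrow> x \<and> Y \<longlonglongrightarrow> y)"

lemma gram_limI:
  "(\<And>n. gram_rel u v (X n) (Y n)) \<Longrightarrow> X \<longlonglongrightarrow> x \<Longrightarrow> Y \<longlonglongrightarrow> y \<Longrightarrow> gram_lim u v x y"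
  unfolding gram_lim_def by blast

lemma gram_lim_add:
  assumes "gram_lim u v x y" "gram_lim u v x' y'"
  shows "gram_lim u v (x + x') (y + y')"
proof -
  obtain X Y where XY: "\<And>n. gram_rel u v (X n) (Y n)" "X \<longlonglongrightarrow> x" "Y \<longlonglongrightarrow> y"
    using assms(1) unfolding gram_lim_def by blast
  obtain X' Y' where XY': "\<And>n. gram_rel u v (X' n) (Y' n)" "X' \<longlonglongrightarrow> x'" "Y' \<longlonglongrightarrow> y'"
    using assms(2) unfolding gram_lim_def by blast
  show ?thesis
    by (rule gram_limI[of u v "\<lambda>n. X n + X' n" "\<lambda>n. Y n + Y' n"])
      (intro gram_rel_add tendsto_add XY XY')+
qed

lemma gram_lim_scale:
  assumes "gram_lim u v x y"
  shows "gram_lim u v (scale c x) (scale c y)"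
proof -
  obtain X Y where XY: "\<And>n. gram_rel u v (X n) (Y n)" "X \<longlonglongrightarrow> x" "Y \<longlonglongrightarrow> y"
    using assms unfolding gram_lim_def by blast
  show ?thesis
    by (rule gram_limI[of u v "\<lambda>n. scale c (X n)" "\<lambda>n. scale c (Y n)"])
      (intro gram_rel_scale tendsto_scale XY)+
qed

lemma gram_lim_swap: "gram_lim u v x y \<Longrightarrow> gram_lim v u y x"
  unfolding gram_lim_def by (metis gram_rel_swap)

lemma gram_lim_generator: "gram_lim u v (u i) (v i)"
  by (rule gram_limI[OF gram_rel_generator tendsto_const tendsto_const])

lemma gram_lim_ip:
  assumes gram: "\<And>i j. ip (u i) (u j) = ip (v i) (v j)"
    and "gram_lim u v x y" "gram_lim u v x' y'"
  shows "ip x x' = ip y y'"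
proof -
  obtain X Y where XY: "\<And>n. gram_rel u v (X n) (Y n)" "X \<longlonglongrightarrow> x" "Y \<longlonglongrightarrow> y"
    using assms(2) unfolding gram_lim_def by blast
  obtain X' Y' where XY': "\<And>n. gram_rel u v (X' n) (Y' n)" "X' \<longlonglongrightarrow> x'" "Y' \<longlonglongrightarrow> y'"
    using assms(3) unfolding gram_lim_def by blast
  have "ip (X n) (X' n) = ip (Y n) (Y' n)" for n
    by (rule gram_rel_ip[of u v, OF gram XY(1) XY'(1)])
  then have "(\<lambda>n. ip (Y n) (Y' n)) \<longlonglongrightarrow> ip x x'"
    using tendsto_ip[OF XY(2) XY'(2)] by simp
  then show ?thesis
    using tendsto_ip[OF XY(3) XY'(3)] LIMSEQ_unique by blast
qed

text \<open>The vector 0 is related to the difference of the two images, and preservation of inner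
  products forces that difference to have norm 0.\<close>

lemma gram_lim_unique:
  assumes gram: "\<And>i j. ip (u i) (u j) = ip (v i) (v j)"
    and "gram_lim u v x y" "gram_lim u v x y'"
  shows "y = y'"
proof -
  have "gram_lim u v 0 (y - y')"
    using gram_lim_add[OF assms(2) gram_lim_scale[OF assms(3), of "- 1"]] by simp
  then have "ip (y - y') (y - y') = 0"
    using gram_lim_ip[of u v, OF gram] ip_zero_left by metis
  then show ?thesis by (simp add: ip_self)
qed

text \<open>The domain of \<open>gram_rel\<close> is a subspace containing every \<open>u i\<close>,
  hence dense. Along an approximating sequence the images are Cauchy since the relation is
  isometric, and completeness gives their limit.\<close>

lemma gram_lim_total:
  assumes gram: "\<And>i j. ip (u i) (u j) = ip (v i) (v j)"
    and total: "\<And>x. (\<And>i. ip x (u i) = 0) \<Longrightarrow> x = 0"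
  shows "\<exists>y. gram_lim u v x y"
proof -
  have "closure {x. \<exists>y. gram_rel u v x y} = UNIV"
  proof (rule dense_if_total)
    fix x assume orth: "\<And>y. y \<in> {x. \<exists>y. gram_rel u v x y} \<Longrightarrow> ip x y = 0"
    show "x = 0"
    proof (rule total, rule orth, rule CollectI, rule exI)
      show "gram_rel u v (u i) (v i)" for i by (rule gram_rel_generator)
    qed
  next
    show "0 \<in> {x. \<exists>y. gram_rel u v x y}" using gram_rel.zero by blast
  qed (auto intro: gram_rel_add gram_rel_scale)
  then have "x \<in> closure {x. \<exists>y. gram_rel u v x y}" by blast
  then obtain X where "\<And>n. \<exists>y. gram_rel u v (X n) y" and X: "X \<longlonglongrightarrow> x"
    by (auto simp: closure_sequential)
  then obtain Y where Y: "\<And>n. gram_rel u v (X n) (Y n)" by metis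
  have "Cauchy X" using X by (rule LIMSEQ_imp_Cauchy)
  then have "Cauchy Y"
    unfolding Cauchy_iff by (simp add: gram_rel_norm_diff[of u v, OF gram Y Y])
  then obtain y where "Y \<longlonglongrightarrow> y" using Cauchy_convergent convergent_def by blast
  then show ?thesis using gram_limI[OF Y X] by blast
qed

lemma unitary_operator_exists:
  assumes gram: "\<And>i j. ip (u i) (u j) = ip (v i) (v j)"
    and u: "\<And>x. (\<And>i. ip x (u i) = 0) \<Longrightarrow> x = 0"
    and v: "\<And>x. (\<And>i. ip x (v i) = 0) \<Longrightarrow> x = 0"
  shows "\<exists>U. unitary_operator scale ip U \<and> (\<forall>i. U (u i) = v i)"
proof -
  obtain U where U: "\<And>x. gram_lim u v x (U x)"
    using gram_lim_total[of u v, OF gram u] by metis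
  have eqI: "U x = y" if "gram_lim u v x y" for x y
    using gram_lim_unique[of u v, OF gram U that] .
  have "unitary_operator scale ip U"
  proof (rule unitary_operatorI)
    show "Vector_Spaces.linear scale scale U"
      unfolding Vector_Spaces.linear_iff
      by (intro conjI allI vector_space_axioms eqI gram_lim_add gram_lim_scale U)
    show "ip (U x) (U y) = ip x y" for x y
      using gram_lim_ip[of u v, OF gram U U] by simp
    \<comment> \<open>Surjectivity is the existence result with \<open>u\<close> and
      \<open>v\<close> exchanged; here totality of \<open>v\<close> enters.\<close>
    have "\<exists>x. gram_lim v u y x" for y
      by (rule gram_lim_total) (use gram v in auto)
    then show "surj U" using eqI gram_lim_swap by (metis surjI)
  qed
  moreover have "U (u i) = v i" for i by (rule eqI[OF gram_lim_generator])
  ultimately show ?thesis by blast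
qed

text \<open>Both \<open>U x\<close> and \<open>V x\<close> have inner product
  \<open>ip x (u i)\<close> with \<open>U (u i)\<close>, so their difference is orthogonal to a
  total family. Asking only that \<open>V\<close> preserve inner products lets a composition of
  unitaries be used directly.\<close>

lemma unitary_operator_eqI:
  assumes U: "unitary_operator scale ip U" and V: "\<And>x y. ip (V x) (V y) = ip x y"
    and UV: "\<And>i. V (u i) = U (u i)" and total: "\<And>x. (\<And>i. ip x (U (u i)) = 0) \<Longrightarrow> x = 0"
  shows "U = V"
proof
  fix x
  have "U x - V x = 0"
    by (rule total) (metis ip_diff_left unitary_operator_ip[OF U] V UV diff_self)
  then show "U x = V x" by simp
qed

end

lemma ennreal_tendsto_0I:
  fixes f :: "'a \<Rightarrow> ennreal"
  assumes "\<And>e::real. 0 < e \<Longrightarrow> \<forall>\<^sub>F x in F. f x \<le> ennreal e"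
  shows "(f \<longlongrightarrow> 0) F"
proof (rule order_tendstoI)
  fix a :: ennreal assume "0 < a"
  then obtain b where b: "0 < b" "b < a" using dense by blast
  then obtain r where r: "b = ennreal r" "0 < r" by (cases b) auto
  have "\<forall>\<^sub>F x in F. f x \<le> b" unfolding r(1) by (rule assms[OF r(2)])
  then show "\<forall>\<^sub>F x in F. f x < a"
    by eventually_elim (use b(2) in simp)
qed simp

section \<open>Continuity of translation in L2 of a Haar measure\<close>

context
  fixes M :: "'g::{topological_group_add, t2_space} measure"
  assumes haar: "left_haar_measure M"
begin

lemma sets_haar [measurable_cong]: "sets M = sets borel"
  using haar by (simp add: left_haar_measure_def)

lemma space_haar: "space M = UNIV"
  using sets_eq_imp_space_eq[OF sets_haar] by simp

lemma measurable_translation: "(+) g \<in> measurable M M"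
proof -
  have "continuous_on UNIV ((+) g)" by (intro continuous_intros)
  then have "(+) g \<in> borel \<rightarrow>\<^sub>M borel" by (rule borel_measurable_continuous_onI)
  then show ?thesis by (simp cong: measurable_cong_sets add: sets_haar)
qed

lemma translation_eq_vimage: "(+) g ` E = (+) (- g) -` (E :: 'g set)"
  by (force simp: image_iff add.assoc[symmetric])

lemma sets_translation: "E \<in> sets M \<Longrightarrow> (+) g ` E \<in> sets M"
  using measurable_sets[OF measurable_translation, of E "- g"]
  by (simp add: translation_eq_vimage space_haar)

lemma emeasure_translation: "E \<in> sets M \<Longrightarrow> emeasure M ((+) g ` E) = emeasure M E"
  using haar by (simp add: left_haar_measure_def)

lemma nn_integral_translation:
  assumes "f \<in> borel_measurable M"
  shows "(\<integral>\<^sup>+p. f (g + p) \<partial>M) = (\<integral>\<^sup>+p. f p \<partial>M)"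
proof -
  have "distr M M ((+) g) = M"
  proof (rule measure_eqI)
    fix E assume E: "E \<in> sets (distr M M ((+) g))"
    then have "emeasure (distr M M ((+) g)) E = emeasure M ((+) g -` E \<inter> space M)"
      by (intro emeasure_distr measurable_translation) simp
    also have "(+) g -` E \<inter> space M = (+) (- g) ` E"
      by (simp add: translation_eq_vimage space_haar)
    also have "emeasure M ((+) (- g) ` E) = emeasure M E"
      using E by (intro emeasure_translation) simp
    finally show "emeasure (distr M M ((+) g)) E = emeasure M E" .
  qed simp
  then show ?thesis
    using nn_integral_distr[OF measurable_translation[of g], of f] assms by simp
qed

section \<open>Regularity and the measure of translated sets\<close>

lemma haar_outer_regular:
  assumes "E \<in> sets M"
  shows "emeasure M E = (INF U\<in>{U. open U \<and> E \<subseteq> U}. emeasure M U)"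
proof -
  have "\<forall>E\<in>sets borel. emeasure M E = (INF U\<in>{U. open U \<and> E \<subseteq> U}. emeasure M U)"
    using haar unfolding left_haar_measure_def by (elim conjE)
  then show ?thesis using assms unfolding sets_haar by (rule bspec)
qed

lemma haar_inner_regular:
  assumes "open U"
  shows "emeasure M U = (SUP K\<in>{K. compact K \<and> K \<subseteq> U}. emeasure M K)"
proof -
  have "\<forall>U. open U \<longrightarrow> emeasure M U = (SUP K\<in>{K. compact K \<and> K \<subseteq> U}. emeasure M K)"
    using haar unfolding left_haar_measure_def by (elim conjE)
  then have "open U \<longrightarrow> emeasure M U = (SUP K\<in>{K. compact K \<and> K \<subseteq> U}. emeasure M K)"
    by (rule spec)
  then show ?thesis using assms by (rule mp)
qed

text \<open>Enclose \<open>E\<close> in an open \<open>U\<close> of nearly the same measure and fill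
  \<open>U\<close> by a compact \<open>K\<close> up to small measure. Translates of \<open>K\<close>
  by \<open>g\<close> near 0 remain in \<open>U\<close>, so whatever leaves \<open>E\<close> lies in
  one of two small remainders.\<close>

lemma tendsto_emeasure_translation_diff:
  assumes E: "E \<in> sets M" and fin: "emeasure M E < \<infinity>"
  shows "((\<lambda>g. emeasure M ((+) g ` E - E)) \<longlongrightarrow> 0) (nhds 0)"
proof (rule ennreal_tendsto_0I)
  fix e :: real assume e: "0 < e"
  have "\<exists>U\<in>{U. open U \<and> E \<subseteq> U}. emeasure M U < emeasure M E + ennreal (e/2)"
  proof (rule INF_approx_ennreal)
    show "emeasure M E = (INF U\<in>{U. open U \<and> E \<subseteq> U}. emeasure M U)"
      using E by (rule haar_outer_regular)
  qed (use e fin in auto)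
  then obtain U where U: "open U" "E \<subseteq> U" "emeasure M U < emeasure M E + ennreal (e/2)"
    by blast
  have [measurable]: "U \<in> sets M" "E \<in> sets M" using U(1) E by (simp_all add: sets_haar)
  have "ennreal (e/2) < \<infinity>" by simp
  then have Ufin: "emeasure M U < \<infinity>"
    using U(3) fin by (metis ennreal_add_less_top infinity_ennreal_def less_trans)
  \<comment> \<open>Inner regularity is applied to the open set \<open>U\<close>, so
    \<open>K\<close> approximates \<open>U\<close> from inside and need not lie in
    \<open>E\<close>.\<close>
  have "\<exists>K\<in>{K. compact K \<and> K \<subseteq> U}. emeasure M U < emeasure M K + ennreal (e/2)"
  proof (rule SUP_approx_ennreal)
    show "emeasure M U = (SUP K\<in>{K. compact K \<and> K \<subseteq> U}. emeasure M K)"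
      using U(1) by (rule haar_inner_regular)
    show "{K. compact K \<and> K \<subseteq> U} \<noteq> {}" using compact_empty by blast
  qed (use e Ufin in auto)
  then obtain K where K: "compact K" "K \<subseteq> U" "emeasure M U < emeasure M K + ennreal (e/2)"
    by blast
  have [measurable]: "K \<in> sets M"
    using K(1) by (simp add: sets_haar compact_imp_closed)
  have UE: "emeasure M (U - E) \<le> ennreal (e/2)"
    using U fin by (subst emeasure_Diff) (auto simp: ennreal_minus_le_iff add.commute less_imp_le)
  have Kfin: "emeasure M K < \<infinity>"
    using emeasure_mono[OF K(2)] Ufin by (metis \<open>U \<in> sets M\<close> order_le_less_trans)
  have UK: "emeasure M (U - K) \<le> ennreal (e/2)"
    using K Kfin by (subst emeasure_Diff) (auto simp: ennreal_minus_le_iff add.commute less_imp_le)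
  \<comment> \<open>Joint continuity of addition and the tube lemma over the compact
    \<open>K\<close> give one neighbourhood \<open>V\<close> of 0 whose elements all translate
    \<open>K\<close> into \<open>U\<close>.\<close>
  have "continuous_on UNIV (\<lambda>z :: 'g \<times> 'g. fst z + snd z)" by (intro continuous_intros)
  then have "open ((\<lambda>z :: 'g \<times> 'g. fst z + snd z) -` U)" using U(1) by (rule open_vimage[rotated])
  moreover have "{0} \<times> K \<subseteq> (\<lambda>z. fst z + snd z) -` U" using K(2) by auto
  ultimately have "\<exists>V. 0 \<in> V \<and> open V \<and> V \<times> K \<subseteq> (\<lambda>z. fst z + snd z) -` U"
    by (rule Elementary_Topology.tube_lemma[OF K(1)])
  then obtain V where V: "0 \<in> V" "open V" "V \<times> K \<subseteq> (\<lambda>z. fst z + snd z) -` U"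
    by blast
  show "\<forall>\<^sub>F g in nhds 0. emeasure M ((+) g ` E - E) \<le> ennreal e"
  proof (rule eventually_nhds[THEN iffD2], intro exI conjI ballI)
    show "open V" "0 \<in> V" by (fact V)+
    fix g assume "g \<in> V"
    then have "(+) g ` K \<subseteq> U" using V(3) by auto
    \<comment> \<open>For \<open>x\<close> in \<open>E\<close> but not in \<open>K\<close>, the
      point \<open>g + x\<close> lies in the translate of \<open>U - K\<close>. For \<open>x\<close>
      in \<open>K\<close> it lies in \<open>U\<close>, hence in \<open>U - E\<close> once it is
      outside \<open>E\<close>.\<close>
    then have "(+) g ` E - E \<subseteq> (+) g ` (U - K) \<union> (U - E)" using U(2) by blast
    then have "emeasure M ((+) g ` E - E) \<le> emeasure M ((+) g ` (U - K) \<union> (U - E))"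
      by (intro emeasure_mono) (auto intro!: sets_translation)
    also have "\<dots> \<le> emeasure M ((+) g ` (U - K)) + emeasure M (U - E)"
      by (intro emeasure_subadditive sets_translation) auto
    also have "\<dots> = emeasure M (U - K) + emeasure M (U - E)"
      by (simp add: emeasure_translation)
    also have "\<dots> \<le> ennreal (e/2) + ennreal (e/2)" by (intro add_mono UK UE)
    also have "\<dots> = ennreal e" using e by (simp flip: ennreal_plus)
    finally show "emeasure M ((+) g ` E - E) \<le> ennreal e" .
  qed
qed

text \<open>The points of \<open>E\<close> outside its translate by \<open>g\<close> are the
  translate by \<open>g\<close> of the points that leave \<open>E\<close> under \<open>- g\<close>.
  Invariance reduces this half to the previous limit along \<open>- g\<close>.\<close>

lemma tendsto_emeasure_symdiff_translation:
  assumes E: "E \<in> sets M" and fin: "emeasure M E < \<infinity>"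
  shows "((\<lambda>g. emeasure M (((+) g ` E - E) \<union> (E - (+) g ` E))) \<longlongrightarrow> 0) (nhds 0)"
proof (rule tendsto_sandwich[where f = "\<lambda>_. 0"])
  have "filterlim (uminus :: 'g \<Rightarrow> 'g) (nhds 0) (nhds 0)"
    using tendsto_uminus_nhds[of "0::'g"] by simp
  then have "((\<lambda>g. emeasure M ((+) g ` E - E) + emeasure M ((+) (- g) ` E - E)) \<longlongrightarrow> 0 + 0) (nhds 0)"
    by (intro tendsto_add tendsto_emeasure_translation_diff[OF assms]
        filterlim_compose[OF tendsto_emeasure_translation_diff[OF assms]])
  then show "((\<lambda>g. emeasure M ((+) g ` E - E) + emeasure M ((+) (- g) ` E - E)) \<longlongrightarrow> 0) (nhds 0)"
    by simp
  show "\<forall>\<^sub>F g in nhds 0. emeasure M (((+) g ` E - E) \<union> (E - (+) g ` E))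
          \<le> emeasure M ((+) g ` E - E) + emeasure M ((+) (- g) ` E - E)"
  proof (rule always_eventually, rule allI)
    fix g
    have "E - (+) g ` E = (+) g ` ((+) (- g) ` E - E)"
      by (auto simp: translation_eq_vimage)
    then have "emeasure M (E - (+) g ` E) = emeasure M ((+) (- g) ` E - E)"
      using E by (simp add: emeasure_translation sets_translation sets.Diff)
    then show "emeasure M (((+) g ` E - E) \<union> (E - (+) g ` E))
          \<le> emeasure M ((+) g ` E - E) + emeasure M ((+) (- g) ` E - E)"
      using E by (metis emeasure_subadditive sets.Diff sets_translation)
  qed
qed simp_all

text \<open>
  The target need not be separable, so the Bochner integral of the library does not apply; f is
  approximated directly, truncating the simple functions s i where they exceed 2 * norm (f x).
\<close>

lemma L2_functions_simple_approximation:
  fixes f :: "'g \<Rightarrow> 'l::banach"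
  assumes f: "f \<in> L2_functions M" and e: "0 < e"
  shows "\<exists>t. simple_function M t \<and> (\<forall>x. norm (t x) \<le> 2 * norm (f x)) \<and>
             (\<lambda>x. (norm (t x - f x))\<^sup>2) \<in> borel_measurable M \<and>
             (\<integral>\<^sup>+x. ennreal ((norm (t x - f x))\<^sup>2) \<partial>M) < ennreal e"
proof -
  have fm [measurable]: "f \<in> borel_measurable M"
    and int: "integrable M (\<lambda>x. (norm (f x))\<^sup>2)"
    using f by (auto simp: L2_functions_def)
  obtain s where s: "\<And>i::nat. simple_function M (s i)"
    and lim: "AE x in M. (\<lambda>i. s i x) \<longlonglongrightarrow> f x"
    using f by (auto simp: L2_functions_def)
  define t where "t i x = (if norm (s i x) \<le> 2 * norm (f x) then s i x else 0)" for i x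
  have t_le: "norm (t i x) \<le> 2 * norm (f x)" for i x by (simp add: t_def)
  have norm_s [measurable]: "(\<lambda>x. norm (s i x)) \<in> borel_measurable M" for i
    using simple_function_compose1[OF s[of i], of norm]
    by (rule borel_measurable_simple_function)
  have t_simple: "simple_function M (t i)" for i
    unfolding t_def by (intro simple_function_If s) auto
  \<comment> \<open>Differences of measurable functions into a nonseparable space need not be
    measurable. Since \<open>t i\<close> takes finitely many values, the norm is a finite sum, over
    its level sets, of measurable functions.\<close>
  have [measurable]: "(\<lambda>x. norm (t i x - f x)) \<in> borel_measurable M" for i
  proof -
    have fin: "finite (range (t i))"
      using simple_functionD(1)[OF t_simple] by (simp add: space_haar)
    have [measurable]: "t i -` {y} \<in> sets M" for y
      using simple_functionD(2)[OF t_simple, of i "{y}"] by (simp add: space_haar)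
    have "norm (t i x - f x)
        = (\<Sum>y\<in>range (t i). indicator (t i -` {y}) x * norm (y - f x))" for x
    proof -
      have "(\<Sum>y\<in>range (t i). indicator (t i -` {y}) x * norm (y - f x))
          = (\<Sum>y\<in>range (t i). if t i x = y then norm (y - f x) else 0)"
        by (intro sum.cong) (auto simp: indicator_def)
      then show ?thesis using fin by simp
    qed
    then have "(\<lambda>x. norm (t i x - f x))
        = (\<lambda>x. \<Sum>y\<in>range (t i). indicator (t i -` {y}) x * norm (y - f x))" by (rule ext)
    moreover have "(\<lambda>x. norm (y - f x)) \<in> borel_measurable M" for y
    proof -
      have "(\<lambda>z. norm (y - z)) \<in> borel \<rightarrow>\<^sub>M borel"
        by (intro borel_measurable_continuous_onI continuous_intros)
      then show ?thesis using fm by (rule measurable_compose[rotated])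
    qed
    ultimately show ?thesis by simp
  qed
  have "(\<lambda>i. \<integral>\<^sup>+x. ennreal ((norm (t i x - f x))\<^sup>2) \<partial>M) \<longlonglongrightarrow> (\<integral>\<^sup>+x. 0 \<partial>M)"
  proof (rule nn_integral_dominated_convergence)
    show "AE x in M. ennreal ((norm (t i x - f x))\<^sup>2) \<le> ennreal (9 * (norm (f x))\<^sup>2)" for i
    proof (rule AE_I2, rule ennreal_leI)
      fix x
      have "norm (t i x - f x) \<le> 3 * norm (f x)"
        using norm_triangle_ineq4[of "t i x" "f x"] t_le[of i x] by linarith
      then have "(norm (t i x - f x))\<^sup>2 \<le> (3 * norm (f x))\<^sup>2" by (rule power_mono) simp
      then show "(norm (t i x - f x))\<^sup>2 \<le> 9 * (norm (f x))\<^sup>2" by (simp add: power_mult_distrib)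
    qed
    have "integrable M (\<lambda>x. 9 * (norm (f x))\<^sup>2)" using int by simp
    then show "(\<integral>\<^sup>+x. ennreal (9 * (norm (f x))\<^sup>2) \<partial>M) < \<infinity>"
      by (simp add: nn_integral_eq_integral)
    show "AE x in M. (\<lambda>i. ennreal ((norm (t i x - f x))\<^sup>2)) \<longlonglongrightarrow> 0"
      using lim
    proof eventually_elim
      fix x assume sx: "(\<lambda>i. s i x) \<longlonglongrightarrow> f x"
      \<comment> \<open>Where \<open>f x = 0\<close> the truncation makes \<open>t i x\<close>
        vanish. Elsewhere the limit of \<open>norm (s i x)\<close> is strictly below the threshold,
        so \<open>t i x\<close> eventually equals \<open>s i x\<close>.\<close>
      have "(\<lambda>i. t i x) \<longlonglongrightarrow> f x"
      proof (cases "f x = 0")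
        case True
        then show ?thesis using t_le[of _ x] by simp
      next
        case False
        then have "norm (f x) < 2 * norm (f x)" by simp
        with tendsto_norm[OF sx] have "\<forall>\<^sub>F i in sequentially. norm (s i x) < 2 * norm (f x)"
          by (rule order_tendstoD(2))
        then have "\<forall>\<^sub>F i in sequentially. s i x = t i x"
          by eventually_elim (simp add: t_def)
        then show ?thesis using sx by (rule Lim_transform_eventually[rotated])
      qed
      then have "(\<lambda>i. ennreal ((norm (t i x - f x))\<^sup>2)) \<longlonglongrightarrow> ennreal ((norm (f x - f x))\<^sup>2)"
        by (intro tendsto_intros)
      then show "(\<lambda>i. ennreal ((norm (t i x - f x))\<^sup>2)) \<longlonglongrightarrow> 0" by simp
    qed
  qed simp_all
  moreover have "(\<integral>\<^sup>+x. 0 \<partial>M) < ennreal e" using e by simp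
  ultimately have "\<forall>\<^sub>F i in sequentially. (\<integral>\<^sup>+x. ennreal ((norm (t i x - f x))\<^sup>2) \<partial>M) < ennreal e"
    by (rule order_tendstoD(2))
  then obtain i where "(\<integral>\<^sup>+x. ennreal ((norm (t i x - f x))\<^sup>2) \<partial>M) < ennreal e"
    by (meson eventually_sequentially order_refl)
  then show ?thesis
    using t_simple[of i] t_le[of i] by (intro exI[of _ "t i"]) simp
qed

text \<open>A simple \<open>t\<close> differs from its translate only on the symmetric differences
  between its nonzero level sets and their translates. There are finitely many of these, and the
  measure of each tends to 0.\<close>

lemma tendsto_L2_translation_simple:
  fixes t :: "'g \<Rightarrow> 'l::banach"
  assumes t: "simple_function M t"
    and fin: "\<And>y. y \<noteq> 0 \<Longrightarrow> emeasure M (t -` {y}) < \<infinity>"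
  shows "((\<lambda>g. \<integral>\<^sup>+p. ennreal ((norm (t (- g + p) - t p))\<^sup>2) \<partial>M) \<longlongrightarrow> 0) (nhds 0)"
proof -
  define Y where "Y = range t - {0}"
  define D where "D g y = ((+) g ` (t -` {y}) - t -` {y}) \<union> (t -` {y} - (+) g ` (t -` {y}))" for g y
  have finite_range: "finite (range t)"
    using simple_functionD(1)[OF t] by (simp add: space_haar)
  have sets_t: "t -` {y} \<in> sets M" for y
    using simple_functionD(2)[OF t, of "{y}"] by (simp add: space_haar)
  then have [measurable]: "D g y \<in> sets M" for g y
    unfolding D_def by (intro sets.Un sets.Diff sets_translation)
  obtain B where B: "\<And>p. norm (t p) \<le> B"
    using finite_imp_bounded[OF finite_range] by (auto simp: bounded_iff)
  have pointwise: "ennreal ((norm (t (- g + p) - t p))\<^sup>2)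
      \<le> (\<Sum>y\<in>Y. ennreal ((2 * B)\<^sup>2) * indicator (D g y) p)" for g p
  proof (cases "t (- g + p) = t p")
    case False
    \<comment> \<open>Of the two distinct values at least one is nonzero; \<open>p\<close> lies in
      exactly one of the level set of that value and its translate.\<close>
    obtain y where y: "y \<in> Y" "p \<in> D g y"
    proof (cases "t p = 0")
      case True
      then show ?thesis
        using False by (intro that[of "t (- g + p)"]) (auto simp: Y_def D_def translation_eq_vimage)
    next
      case False
      then show ?thesis
        using \<open>t (- g + p) \<noteq> t p\<close>
        by (intro that[of "t p"]) (auto simp: Y_def D_def translation_eq_vimage)
    qed
    have "norm (t (- g + p) - t p) \<le> 2 * B"
      using norm_triangle_ineq4[of "t (- g + p)" "t p"] B[of p] B[of "- g + p"] by linarith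
    then have "(norm (t (- g + p) - t p))\<^sup>2 \<le> (2 * B)\<^sup>2" by (rule power_mono) simp
    then have "ennreal ((norm (t (- g + p) - t p))\<^sup>2) \<le> ennreal ((2 * B)\<^sup>2) * indicator (D g y) p"
      using y(2) by (simp add: ennreal_leI)
    also have "\<dots> \<le> (\<Sum>y\<in>Y. ennreal ((2 * B)\<^sup>2) * indicator (D g y) p)"
      using y(1) finite_range by (intro member_le_sum) (auto simp: Y_def)
    finally show ?thesis .
  qed simp
  show ?thesis
  proof (rule tendsto_sandwich[where f = "\<lambda>_. 0"])
    show "\<forall>\<^sub>F g in nhds 0. (\<integral>\<^sup>+p. ennreal ((norm (t (- g + p) - t p))\<^sup>2) \<partial>M)
        \<le> (\<Sum>y\<in>Y. ennreal ((2 * B)\<^sup>2) * emeasure M (D g y))"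
    proof (rule always_eventually, rule allI)
      fix g
      have "(\<integral>\<^sup>+p. ennreal ((norm (t (- g + p) - t p))\<^sup>2) \<partial>M)
          \<le> (\<integral>\<^sup>+p. (\<Sum>y\<in>Y. ennreal ((2 * B)\<^sup>2) * indicator (D g y) p) \<partial>M)"
        by (intro nn_integral_mono pointwise)
      also have "\<dots> = (\<Sum>y\<in>Y. ennreal ((2 * B)\<^sup>2) * emeasure M (D g y))"
        by (subst nn_integral_sum) (simp_all add: nn_integral_cmult_indicator)
      finally show "(\<integral>\<^sup>+p. ennreal ((norm (t (- g + p) - t p))\<^sup>2) \<partial>M)
          \<le> (\<Sum>y\<in>Y. ennreal ((2 * B)\<^sup>2) * emeasure M (D g y))" .
    qed
    have "((\<lambda>g. \<Sum>y\<in>Y. ennreal ((2 * B)\<^sup>2) * emeasure M (D g y)) \<longlongrightarrow>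
        (\<Sum>y\<in>Y. ennreal ((2 * B)\<^sup>2) * 0)) (nhds 0)"
    proof (intro tendsto_sum ennreal_tendsto_cmult)
      fix y assume "y \<in> Y"
      then have "emeasure M (t -` {y}) < \<infinity>" using fin by (simp add: Y_def)
      then show "((\<lambda>g. emeasure M (D g y)) \<longlongrightarrow> 0) (nhds 0)"
        unfolding D_def by (intro tendsto_emeasure_symdiff_translation sets_t)
    qed simp
    then show "((\<lambda>g. \<Sum>y\<in>Y. ennreal ((2 * B)\<^sup>2) * emeasure M (D g y)) \<longlongrightarrow> 0) (nhds 0)"
      by simp
  qed simp_all
qed

text \<open>The error of approximating \<open>f\<close> by a simple \<open>t\<close> is unchanged by
  translation, and \<open>t\<close> is covered by the simple case. The tolerance \<open>e/9\<close>
  accounts for three error terms and the factor 3 in bounding the square of their sum.\<close>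

lemma tendsto_L2_translation:
  fixes f :: "'g \<Rightarrow> 'l::banach"
  assumes f: "f \<in> L2_functions M"
  shows "((\<lambda>g. \<integral>\<^sup>+p. ennreal ((norm (f (- g + p) - f p))\<^sup>2) \<partial>M) \<longlongrightarrow> 0) (nhds 0)"
proof (rule ennreal_tendsto_0I)
  fix e :: real assume "0 < e"
  then obtain t where t: "simple_function M t" and t_le: "\<And>x. norm (t x) \<le> 2 * norm (f x)"
    and [measurable]: "(\<lambda>x. (norm (t x - f x))\<^sup>2) \<in> borel_measurable M"
    and approx: "(\<integral>\<^sup>+x. ennreal ((norm (t x - f x))\<^sup>2) \<partial>M) < ennreal (e/9)"
    using L2_functions_simple_approximation[OF f, of "e/9"] by auto
  have int: "integrable M (\<lambda>x. (norm (f x))\<^sup>2)" using f by (simp add: L2_functions_def)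
  have sets_t: "t -` {y} \<in> sets M" for y
    using simple_functionD(2)[OF t, of "{y}"] by (simp add: space_haar)
  \<comment> \<open>Chebyshev: on the level set of \<open>y\<close>, \<open>norm y\<close> is at
    most \<open>2 * norm (f x)\<close>, and \<open>f\<close> is square-integrable.\<close>
  have "emeasure M (t -` {y}) < \<infinity>" if "y \<noteq> 0" for y
  proof -
    have "ennreal ((norm y)\<^sup>2) * emeasure M (t -` {y})
        = (\<integral>\<^sup>+x. ennreal ((norm y)\<^sup>2) * indicator (t -` {y}) x \<partial>M)"
      by (rule nn_integral_cmult_indicator[symmetric]) (rule sets_t)
    also have "\<dots> \<le> (\<integral>\<^sup>+x. ennreal (4 * (norm (f x))\<^sup>2) \<partial>M)"
    proof (rule nn_integral_mono)
      fix x
      have "(norm (t x))\<^sup>2 \<le> (2 * norm (f x))\<^sup>2" by (intro power_mono t_le) simp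
      then show "ennreal ((norm y)\<^sup>2) * indicator (t -` {y}) x \<le> ennreal (4 * (norm (f x))\<^sup>2)"
        by (auto simp: indicator_def power_mult_distrib intro!: ennreal_leI)
    qed
    also have "\<dots> < \<infinity>"
      using int by (simp add: nn_integral_eq_integral)
    finally show ?thesis using that by (auto simp: ennreal_mult_less_top)
  qed
  then have "((\<lambda>g. \<integral>\<^sup>+p. ennreal ((norm (t (- g + p) - t p))\<^sup>2) \<partial>M) \<longlongrightarrow> 0) (nhds 0)"
    by (rule tendsto_L2_translation_simple[OF t])
  then have "\<forall>\<^sub>F g in nhds 0. (\<integral>\<^sup>+p. ennreal ((norm (t (- g + p) - t p))\<^sup>2) \<partial>M) < ennreal (e/9)"
    by (rule order_tendstoD(2)) (use \<open>0 < e\<close> in simp)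
  then show "\<forall>\<^sub>F g in nhds 0. (\<integral>\<^sup>+p. ennreal ((norm (f (- g + p) - f p))\<^sup>2) \<partial>M) \<le> ennreal e"
  proof eventually_elim
    fix g assume close: "(\<integral>\<^sup>+p. ennreal ((norm (t (- g + p) - t p))\<^sup>2) \<partial>M) < ennreal (e/9)"
    let ?a = "\<lambda>p. ennreal ((norm (t p - f p))\<^sup>2)"
    let ?b = "\<lambda>p. ennreal ((norm (t (- g + p) - t p))\<^sup>2)"
    have t_translate: "simple_function M (\<lambda>p. t (- g + p))"
      using simple_function_comp[OF measurable_translation t, of "- g"] by (simp add: comp_def)
    have b [measurable]: "?b \<in> borel_measurable M"
      by (rule borel_measurable_simple_function)
        (intro simple_function_compose2[OF t_translate t, of "\<lambda>x y. ennreal ((norm (x - y))\<^sup>2)"])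
    have a [measurable]: "?a \<in> borel_measurable M" by measurable
    have a_translate [measurable]: "(\<lambda>p. ?a (- g + p)) \<in> borel_measurable M"
      by (rule measurable_compose[OF measurable_translation a])
    have "(norm (f (- g + p) - f p))\<^sup>2
        \<le> 3 * ((norm (t (- g + p) - f (- g + p)))\<^sup>2 + (norm (t (- g + p) - t p))\<^sup>2 + (norm (t p - f p))\<^sup>2)"
      for p
    proof -
      define a b c where "a = norm (t (- g + p) - f (- g + p))" and "b = norm (t (- g + p) - t p)"
        and "c = norm (t p - f p)"
      have "f (- g + p) - f p
          = (t (- g + p) - t p) + (t p - f p) - (t (- g + p) - f (- g + p))" by simp
      then have "norm (f (- g + p) - f p) \<le> b + c + a"
        unfolding a_def b_def c_def
        by (metis (no_types) add_right_mono norm_triangle_ineq norm_triangle_ineq4 order_trans)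
      then have "(norm (f (- g + p) - f p))\<^sup>2 \<le> (b + c + a)\<^sup>2" by (rule power_mono) simp
      also have "\<dots> \<le> 3 * (a\<^sup>2 + b\<^sup>2 + c\<^sup>2)"
        using zero_le_power2[of "a - b"] zero_le_power2[of "b - c"] zero_le_power2[of "a - c"]
        by (simp add: power2_eq_square algebra_simps)
      finally show ?thesis by (simp add: a_def b_def c_def)
    qed
    \<comment> \<open>The translated difference of \<open>f\<close> need not be measurable, so only
      monotonicity is applied to it; additivity is used for the measurable majorant.\<close>
    then have "(\<integral>\<^sup>+p. ennreal ((norm (f (- g + p) - f p))\<^sup>2) \<partial>M)
        \<le> (\<integral>\<^sup>+p. ennreal 3 * (?a (- g + p) + ?b p + ?a p) \<partial>M)"
      by (intro nn_integral_mono) (simp flip: ennreal_plus ennreal_mult del: ennreal_numeral add: ennreal_leI)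
    also have "\<dots> = ennreal 3 * ((\<integral>\<^sup>+p. ?a (- g + p) \<partial>M) + (\<integral>\<^sup>+p. ?b p \<partial>M) + (\<integral>\<^sup>+p. ?a p \<partial>M))"
      by (simp only: nn_integral_cmult nn_integral_add borel_measurable_add a b a_translate)
    also have "(\<integral>\<^sup>+p. ?a (- g + p) \<partial>M) = (\<integral>\<^sup>+p. ?a p \<partial>M)"
      by (rule nn_integral_translation) simp
    also have "ennreal 3 * ((\<integral>\<^sup>+p. ?a p \<partial>M) + (\<integral>\<^sup>+p. ?b p \<partial>M) + (\<integral>\<^sup>+p. ?a p \<partial>M))
        \<le> ennreal 3 * (ennreal (e/9) + ennreal (e/9) + ennreal (e/9))"
      using approx close by (intro mult_left_mono add_mono) auto
    also have "\<dots> = ennreal e"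
      using \<open>0 < e\<close> by (simp flip: ennreal_plus ennreal_mult del: ennreal_numeral)
    finally show "(\<integral>\<^sup>+p. ennreal ((norm (f (- g + p) - f p))\<^sup>2) \<partial>M) \<le> ennreal e" .
  qed
qed

end

section \<open>Parseval frames and the intertwining representation\<close>

lemma (in hilbert_space) weak_integral_eqI:
  assumes "has_weak_integral ip M F y"
  shows "weak_integral ip M F = y"
  unfolding weak_integral_def
proof (rule the_equality)
  show "has_weak_integral ip M F y" by (rule assms)
  fix z assume "has_weak_integral ip M F z"
  then show "z = y"
    using assms unfolding has_weak_integral_def by (intro ip_left_eqI) simp
qed

text \<open>Moving \<open>Y\<close> across its adjoint turns the operator relations of the theorem
  into equalities of Gram matrix entries.\<close>

lemma ip_hadjoint_hadjoint:
  fixes scale :: "'k::real_or_complex \<Rightarrow> 'h::banach \<Rightarrow> 'h" and ip :: "'h \<Rightarrow> 'h \<Rightarrow> 'k"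
    and scale0 :: "'k \<Rightarrow> 'l::banach \<Rightarrow> 'l" and ip0 :: "'l \<Rightarrow> 'l \<Rightarrow> 'k"
  assumes "hilbert_space scale ip" "hilbert_space scale0 ip0" "bounded_operator scale scale0 Y"
  shows "ip (hadjoint ip ip0 X y) (hadjoint ip ip0 Y z) = ip0 ((Y \<circ> hadjoint ip ip0 X) y) z"
  by (simp add: hadjoint_eq[OF assms])

text \<open>The adjoint reverses the composition, and \<open>U\<close> cancels its own adjoint. As
  \<open>U\<close> is onto, testing against vectors \<open>U x'\<close> suffices.\<close>

lemma unitary_apply_hadjoint_comp:
  fixes scale :: "'k::real_or_complex \<Rightarrow> 'h::banach \<Rightarrow> 'h" and ip :: "'h \<Rightarrow> 'h \<Rightarrow> 'k"
    and scale0 :: "'k \<Rightarrow> 'l::banach \<Rightarrow> 'l" and ip0 :: "'l \<Rightarrow> 'l \<Rightarrow> 'k"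
  assumes H: "hilbert_space scale ip" and H0: "hilbert_space scale0 ip0"
    and Y: "bounded_operator scale scale0 Y" and YU: "bounded_operator scale scale0 (Y \<circ> U)"
    and U: "unitary_operator scale ip U"
  shows "U (hadjoint ip ip0 (Y \<circ> U) y) = hadjoint ip ip0 Y y"
proof -
  interpret H: hilbert_space scale ip by (rule H)
  show ?thesis
  proof (rule H.ip_right_eqI)
    fix x
    obtain x' where x: "x = U x'"
      using U by (metis unitary_operator_def comp_apply id_apply)
    have "ip (U x') (U (hadjoint ip ip0 (Y \<circ> U) y)) = ip x' (hadjoint ip ip0 (Y \<circ> U) y)"
      by (rule H.unitary_operator_ip[OF U])
    also have "\<dots> = ip0 (Y (U x')) y"
      using hadjoint_eq[OF H H0 YU, of x' y] by simp
    also have "\<dots> = ip (U x') (hadjoint ip ip0 Y y)"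
      by (rule hadjoint_eq[OF H H0 Y])
    finally show "ip x (U (hadjoint ip ip0 (Y \<circ> U) y)) = ip x (hadjoint ip ip0 Y y)"
      by (simp only: x)
  qed
qed

text \<open>The Parseval property writes \<open>ip w w\<close> as the integral of the pairing of
  \<open>A \<alpha> w\<close> with \<open>\<Psi> \<alpha> w\<close>. A weighted arithmetic-geometric
  mean inequality splits the pairing so that the \<open>\<Psi>\<close> term is at most half of
  \<open>(norm w)\<^sup>2\<close> and is absorbed on the left.\<close>

lemma parseval_ov_frame_lower_bound:
  fixes scale :: "'k::real_or_complex \<Rightarrow> 'h::banach \<Rightarrow> 'h" and ip :: "'h \<Rightarrow> 'h \<Rightarrow> 'k"
    and scale0 :: "'k \<Rightarrow> 'l::banach \<Rightarrow> 'l" and ip0 :: "'l \<Rightarrow> 'l \<Rightarrow> 'k"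
  assumes H: "hilbert_space scale ip" and H0: "hilbert_space scale0 ip0"
    and frame: "parseval_ov_frame scale ip scale0 ip0 M A \<Psi>"
  shows "\<exists>D>0. \<forall>w. (norm w)\<^sup>2 \<le> D * (\<integral>\<alpha>. (norm (A \<alpha> w))\<^sup>2 \<partial>M)"
proof -
  interpret H: hilbert_space scale ip by (rule H)
  interpret H0: hilbert_space scale0 ip0 by (rule H0)
  have cf: "continuous_ov_frame scale ip scale0 ip0 M A \<Psi>"
    and id: "frame_operator ip ip0 M A \<Psi> = id"
    using frame by (auto simp: parseval_ov_frame_def)
  obtain C where C: "\<And>w. L2_norm_of M (\<lambda>\<alpha>. \<Psi> \<alpha> w) \<le> C * norm w"
    using cf by (auto simp: continuous_ov_frame_def bounded_into_L2_def analysis_operator_def)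
  \<comment> \<open>The square of \<open>C\<close> bounds the \<open>\<Psi>\<close> integral
    relative to \<open>(norm w)\<^sup>2\<close>; adding 1 keeps \<open>D\<close> positive even if
    \<open>C = 0\<close>.\<close>
  define D where "D = C\<^sup>2 + 1"
  have D: "0 < D" by (simp add: D_def add_nonneg_pos)
  have "(norm w)\<^sup>2 \<le> D * (\<integral>\<alpha>. (norm (A \<alpha> w))\<^sup>2 \<partial>M)" for w
  proof -
    have int_A: "integrable M (\<lambda>\<alpha>. (norm (A \<alpha> w))\<^sup>2)"
      and int_\<Psi>: "integrable M (\<lambda>\<alpha>. (norm (\<Psi> \<alpha> w))\<^sup>2)"
      using cf by (auto simp: continuous_ov_frame_def bounded_into_L2_def analysis_operator_def
          L2_functions_def)
    let ?F = "\<lambda>\<alpha>. ip (hadjoint ip ip0 (\<Psi> \<alpha>) (A \<alpha> w)) w"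
    obtain y where y: "has_weak_integral ip M (\<lambda>\<alpha>. hadjoint ip ip0 (\<Psi> \<alpha>) (A \<alpha> w)) y"
      using cf unfolding continuous_ov_frame_def by blast
    \<comment> \<open>The weak integral is the value of the frame operator at \<open>w\<close>, and
      that operator is the identity.\<close>
    then have "y = w"
      using H.weak_integral_eqI[OF y] fun_cong[OF id, of w] by (simp add: frame_operator_def)
    with y have int_F: "integrable M ?F" and F: "ip w w = (\<integral>\<alpha>. ?F \<alpha> \<partial>M)"
      by (auto simp: has_weak_integral_def)
    have F_le: "norm (?F \<alpha>) \<le> (D * (norm (A \<alpha> w))\<^sup>2 + (norm (\<Psi> \<alpha> w))\<^sup>2 / D) / 2"
      if "\<alpha> \<in> space M" for \<alpha>
    proof -
      have "bounded_operator scale scale0 (\<Psi> \<alpha>)"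
        using cf that by (auto simp: continuous_ov_frame_def)
      then have "?F \<alpha> = conj (ip0 (\<Psi> \<alpha> w) (A \<alpha> w))"
        by (metis H.ip_conj_sym hadjoint_eq[OF H H0])
      then have "norm (?F \<alpha>) \<le> norm (A \<alpha> w) * norm (\<Psi> \<alpha> w)"
        using H0.Cauchy_Schwarz_ip[of "\<Psi> \<alpha> w" "A \<alpha> w"] by (simp add: norm_conj mult.commute)
      moreover have "a * b \<le> (D * a\<^sup>2 + b\<^sup>2 / D) / 2" for a b :: real
      proof -
        have "0 \<le> (D * a - b)\<^sup>2 / D" using D by simp
        also have "\<dots> = D * a\<^sup>2 + b\<^sup>2 / D - 2 * (a * b)"
          using D by (simp add: power2_diff field_simps power2_eq_square)
        finally show ?thesis by simp
      qed
      ultimately show ?thesis by (rule order_trans)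
    qed
    have "L2_norm_of M (\<lambda>\<alpha>. \<Psi> \<alpha> w) = sqrt (\<integral>\<alpha>. (norm (\<Psi> \<alpha> w))\<^sup>2 \<partial>M)"
      by (simp add: L2_norm_of_def)
    moreover have "0 \<le> (\<integral>\<alpha>. (norm (\<Psi> \<alpha> w))\<^sup>2 \<partial>M)" by simp
    ultimately have "(\<integral>\<alpha>. (norm (\<Psi> \<alpha> w))\<^sup>2 \<partial>M) \<le> (C * norm w)\<^sup>2"
      using power_mono[OF C[of w], of 2] by simp
    also have "\<dots> \<le> D * (norm w)\<^sup>2"
      by (simp add: D_def power_mult_distrib distrib_right)
    finally have \<Psi>_le: "(\<integral>\<alpha>. (norm (\<Psi> \<alpha> w))\<^sup>2 \<partial>M) / D \<le> (norm w)\<^sup>2"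
      using D by (simp add: divide_le_eq mult.commute)
    have "(norm w)\<^sup>2 = norm (ip w w)" by (simp add: H.ip_self norm_power)
    also have "\<dots> \<le> (\<integral>\<alpha>. norm (?F \<alpha>) \<partial>M)"
      unfolding F by (rule integral_norm_bound)
    also have "\<dots> \<le> (\<integral>\<alpha>. (D * (norm (A \<alpha> w))\<^sup>2 + (norm (\<Psi> \<alpha> w))\<^sup>2 / D) / 2 \<partial>M)"
      using int_A int_\<Psi> int_F F_le by (intro integral_mono) auto
    also have "\<dots> = (D * (\<integral>\<alpha>. (norm (A \<alpha> w))\<^sup>2 \<partial>M) + (\<integral>\<alpha>. (norm (\<Psi> \<alpha> w))\<^sup>2 \<partial>M) / D) / 2"
      using int_A int_\<Psi> by simp
    also have "\<dots> \<le> (D * (\<integral>\<alpha>. (norm (A \<alpha> w))\<^sup>2 \<partial>M) + (norm w)\<^sup>2) / 2"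
      by (intro divide_right_mono add_left_mono \<Psi>_le) simp
    finally show ?thesis by simp
  qed
  then show ?thesis using D by blast
qed

text \<open>
  With w = \<pi> g h - h, the lower frame bound controls the norm of w by the L2 norm of p \<open>\<mapsto>\<close> A p w,
  which is the difference of p \<open>\<mapsto>\<close> A p h and its translate by g.
\<close>

lemma unitary_representationI_frame:
  fixes scale :: "'k::real_or_complex \<Rightarrow> 'h::banach \<Rightarrow> 'h" and ip :: "'h \<Rightarrow> 'h \<Rightarrow> 'k"
    and scale0 :: "'k \<Rightarrow> 'l::banach \<Rightarrow> 'l" and ip0 :: "'l \<Rightarrow> 'l \<Rightarrow> 'k"
    and M :: "'g::{topological_group_add, t2_space} measure"
  assumes H: "hilbert_space scale ip" and H0: "hilbert_space scale0 ip0"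
    and haar: "left_haar_measure M"
    and frame: "parseval_ov_frame scale ip scale0 ip0 M A \<Psi>"
    and U: "\<And>g. unitary_operator scale ip (\<pi> g)"
    and hom: "\<And>g p. \<pi> (g + p) = \<pi> g \<circ> \<pi> p"
    and A: "\<And>g. A g = A 0 \<circ> \<pi> (- g)"
  shows "unitary_representation scale ip \<pi>"
proof -
  interpret H: hilbert_space scale ip by (rule H)
  have cf: "continuous_ov_frame scale ip scale0 ip0 M A \<Psi>"
    using frame by (simp add: parseval_ov_frame_def)
  have bounded_A: "bounded_operator scale scale0 (A p)" for p
    using cf by (simp add: continuous_ov_frame_def space_haar[OF haar])
  have L2: "(\<lambda>p. A p h) \<in> L2_functions M" for h
    using cf by (simp add: continuous_ov_frame_def bounded_into_L2_def analysis_operator_def)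
  obtain D where D: "0 < D"
    and lower: "\<And>w. (norm w)\<^sup>2 \<le> D * (\<integral>p. (norm (A p w))\<^sup>2 \<partial>M)"
    using parseval_ov_frame_lower_bound[OF H H0 frame] by blast
  have A_diff: "A p (x - y) = A p x - A p y" for p x y
  proof -
    interpret Ap: Vector_Spaces.linear scale scale0 "A p"
      using bounded_A[of p] by (simp add: bounded_operator_def)
    show ?thesis by (rule Ap.diff)
  qed
  \<comment> \<open>The analysis operator of \<open>A\<close> intertwines \<open>\<pi> g\<close>
    with left translation by \<open>g\<close>.\<close>
  have A_shift: "A p (\<pi> g h) = A (- g + p) h" for g p h
  proof -
    have "A p (\<pi> g h) = A 0 (\<pi> (- p + g) h)"
      by (subst A) (simp add: hom)
    also have "\<dots> = A (- g + p) h"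
      by (subst A[of "- g + p"]) (simp add: minus_add)
    finally show ?thesis .
  qed
  have at_0: "((\<lambda>g. \<pi> g h) \<longlongrightarrow> h) (nhds 0)" for h
  proof (rule tendstoI)
    fix e :: real assume e: "0 < e"
    \<comment> \<open>With this choice \<open>D * d\<close> is half of \<open>e\<^sup>2\<close>,
      which leaves room for a strict inequality at the end.\<close>
    define d where "d = e\<^sup>2 / (2 * D)"
    have d: "0 < d" using e D by (simp add: d_def)
    have "\<forall>\<^sub>F g in nhds 0.
        (\<integral>\<^sup>+p. ennreal ((norm (A (- g + p) h - A p h))\<^sup>2) \<partial>M) < ennreal d"
      by (rule order_tendstoD(2)[OF tendsto_L2_translation[OF haar L2]]) (use d in simp)
    then show "\<forall>\<^sub>F g in nhds 0. dist (\<pi> g h) h < e"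
    proof eventually_elim
      fix g
      let ?w = "\<pi> g h - h"
      assume "(\<integral>\<^sup>+p. ennreal ((norm (A (- g + p) h - A p h))\<^sup>2) \<partial>M) < ennreal d"
      then have "(\<integral>\<^sup>+p. ennreal ((norm (A p ?w))\<^sup>2) \<partial>M) < ennreal d"
        by (simp add: A_diff A_shift)
      moreover have "integrable M (\<lambda>p. (norm (A p ?w))\<^sup>2)"
        using L2[of ?w] by (simp add: L2_functions_def)
      ultimately have "ennreal (\<integral>p. (norm (A p ?w))\<^sup>2 \<partial>M) < ennreal d"
        by (simp add: nn_integral_eq_integral)
      then have small: "(\<integral>p. (norm (A p ?w))\<^sup>2 \<partial>M) \<le> d"
        using d by (simp add: ennreal_less_iff)
      have "(norm ?w)\<^sup>2 \<le> D * d"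
        using lower[of ?w] mult_left_mono[OF small] D by (meson less_imp_le order_trans)
      also have "\<dots> < e\<^sup>2" using e D by (simp add: d_def)
      finally show "dist (\<pi> g h) h < e"
        using e by (simp add: dist_norm power_less_imp_less_base)
    qed
  qed
  \<comment> \<open>Continuity is moved from 0 to \<open>g0\<close>: the difference
    \<open>\<pi> g h - \<pi> g0 h\<close> is the image of \<open>\<pi> (- g0 + g) h - h\<close>
    under the isometry \<open>\<pi> g0\<close>.\<close>
  have "((\<lambda>g. \<pi> g h) \<longlongrightarrow> \<pi> g0 h) (nhds g0)" for g0 h
  proof (rule LIM_zero_cancel, rule tendsto_norm_zero_cancel)
    have "((\<lambda>g. - g0 + g) \<longlongrightarrow> - g0 + g0) (nhds g0)"
      by (intro tendsto_add tendsto_const filterlim_ident)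
    then have "filterlim (\<lambda>g. - g0 + g) (nhds 0) (nhds g0)" by simp
    then have "((\<lambda>g. \<pi> (- g0 + g) h) \<longlongrightarrow> h) (nhds g0)"
      by (rule filterlim_compose[OF at_0])
    then have "((\<lambda>g. norm (\<pi> (- g0 + g) h - h)) \<longlongrightarrow> 0) (nhds g0)"
      by (intro tendsto_norm_zero LIM_zero)
    moreover have "norm (\<pi> (- g0 + g) h - h) = norm (\<pi> g h - \<pi> g0 h)" for g
    proof -
      interpret Ug: Vector_Spaces.linear scale scale "\<pi> g0"
        using U[of g0] by (simp add: unitary_operator_def bounded_operator_def)
      have "\<pi> g h = \<pi> g0 (\<pi> (- g0 + g) h)"
        using fun_cong[OF hom[of g0 "- g0 + g"], of h] by (simp add: add.assoc[symmetric])
      then have "\<pi> g h - \<pi> g0 h = \<pi> g0 (\<pi> (- g0 + g) h - h)"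
        by (simp add: Ug.diff)
      then show ?thesis by (simp only: H.unitary_operator_norm[OF U])
    qed
    ultimately show "((\<lambda>g. norm (\<pi> g h - \<pi> g0 h)) \<longlongrightarrow> 0) (nhds g0)" by simp
  qed
  then have "continuous_on UNIV (\<lambda>g. \<pi> g h)" for h
    unfolding continuous_on_def using at_within_le_nhds by (blast intro: tendsto_mono)
  then show ?thesis
    unfolding unitary_representation_def using U hom by blast
qed

theorem theorem4p3:
  fixes scale :: "'k::real_or_complex \<Rightarrow> 'h::banach \<Rightarrow> 'h"
    and ip :: "'h \<Rightarrow> 'h \<Rightarrow> 'k"
    and scale0 :: "'k \<Rightarrow> 'h0::banach \<Rightarrow> 'h0"
    and ip0 :: "'h0 \<Rightarrow> 'h0 \<Rightarrow> 'k"
    and \<mu> :: "'g::{topological_group_add, t2_space} measure"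
    and A \<Psi> :: "'g \<Rightarrow> 'h \<Rightarrow> 'h0"
  assumes "hilbert_space scale ip"
    and "hilbert_space scale0 ip0"
    and "locally_compact_space (euclidean :: 'g topology)"
    and "left_haar_measure \<mu>"
    and "parseval_ov_frame scale ip scale0 ip0 \<mu> A \<Psi>"
  shows "(\<exists>\<pi>. unitary_representation scale ip \<pi> \<and>
            (\<forall>g. A g = A 0 \<circ> \<pi> (- g) \<and> \<Psi> g = \<Psi> 0 \<circ> \<pi> (- g))) \<longleftrightarrow>
         (\<forall>g p q.
            A (g + p) \<circ> hadjoint ip ip0 (A (g + q)) = A p \<circ> hadjoint ip ip0 (A q) \<and>
            A (g + p) \<circ> hadjoint ip ip0 (\<Psi> (g + q)) = A p \<circ> hadjoint ip ip0 (\<Psi> q) \<and>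
            \<Psi> (g + p) \<circ> hadjoint ip ip0 (\<Psi> (g + q)) = \<Psi> p \<circ> hadjoint ip ip0 (\<Psi> q))"
    (is "?L \<longleftrightarrow> ?R")
proof
  note H = assms(1) and H0 = assms(2) and haar = assms(4) and frame = assms(5)
  interpret H: hilbert_space scale ip by (rule H)
  interpret H0: hilbert_space scale0 ip0 by (rule H0)
  let ?adj = "hadjoint ip ip0"
  have bA: "bounded_operator scale scale0 (A p)"
    and b\<Psi>: "bounded_operator scale scale0 (\<Psi> p)" for p
    using frame by (simp_all add: parseval_ov_frame_def continuous_ov_frame_def space_haar[OF haar])
  {

    \<comment> \<open>From a representation to the invariance relations\<close>
    assume ?L
    then obtain \<pi> where \<pi>: "unitary_representation scale ip \<pi>"
      and A: "\<And>g. A g = A 0 \<circ> \<pi> (- g)" and \<Psi>: "\<And>g. \<Psi> g = \<Psi> 0 \<circ> \<pi> (- g)"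
      by blast
    have U: "unitary_operator scale ip (\<pi> g)" for g
      using \<pi> by (simp add: unitary_representation_def)
    have hom: "\<pi> (g + p) = \<pi> g \<circ> \<pi> p" for g p
      using \<pi> by (simp add: unitary_representation_def)
    \<comment> \<open>All three relations are instances with \<open>X\<close> and \<open>Y\<close>
      chosen from \<open>A\<close> and \<open>\<Psi>\<close>. Shifting the index by \<open>g\<close>
      inserts \<open>\<pi> (- g)\<close>, which cancels between \<open>X\<close> and the adjoint of
      \<open>Y\<close>.\<close>
    have invariant: "X (g + p) \<circ> ?adj (Y (g + q)) = X p \<circ> ?adj (Y q)"
      if X: "\<And>g. X g = X 0 \<circ> \<pi> (- g)" and Y: "\<And>g. Y g = Y 0 \<circ> \<pi> (- g)"
        and bY: "\<And>g. bounded_operator scale scale0 (Y g)" for X Y :: "'g \<Rightarrow> 'h \<Rightarrow> 'h0" and g p q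
    proof
      fix y
      have "Z (g + r) = Z r \<circ> \<pi> (- g)" if "\<And>g. Z g = Z 0 \<circ> \<pi> (- g)"
        for Z :: "'g \<Rightarrow> 'h \<Rightarrow> 'h0" and r
        using that[of "g + r"] that[of r] hom[of "- r" "- g"] by (simp add: minus_add comp_assoc)
      note shift = this[OF X, of p] this[OF Y, of q]
      have "\<pi> (- g) (?adj (Y (g + q)) y) = ?adj (Y q) y"
        unfolding shift(2) by (rule unitary_apply_hadjoint_comp[OF H H0 bY _ U])
          (use bY[of "g + q"] shift(2) in simp)
      then show "(X (g + p) \<circ> ?adj (Y (g + q))) y = (X p \<circ> ?adj (Y q)) y"
        by (simp add: shift(1))
    qed
    show ?R
      using invariant[OF A A bA] invariant[OF A \<Psi> b\<Psi>] invariant[OF \<Psi> \<Psi> b\<Psi>] by blast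
  }
  {

    \<comment> \<open>From the invariance relations to a representation\<close>
    assume R: ?R
    obtain D where "0 < D" and lower: "\<And>w. (norm w)\<^sup>2 \<le> D * (\<integral>p. (norm (A p w))\<^sup>2 \<partial>\<mu>)"
      using parseval_ov_frame_lower_bound[OF H H0 frame] by blast
    \<comment> \<open>Orthogonality to the ranges of all adjoints means that every
      \<open>A p\<close> annihilates \<open>x\<close>, and the lower frame bound then forces
      \<open>x = 0\<close>.\<close>
    have total: "x = 0" if orth: "\<And>p y. ip x (?adj (A p) y) = 0" for x
    proof -
      have "A p x = 0" for p
        by (rule H0.ip_left_eqI) (simp add: hadjoint_eq[OF H H0 bA] orth H0.ip_zero_left)
      then show ?thesis using lower[of x] by simp
    qed
    have total_shift: "x = 0" if orth: "\<And>p y. ip x (?adj (A (g + p)) y) = 0" for g x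
    proof (rule total)
      show "ip x (?adj (A p) y) = 0" for p y
        using orth[of "- g + p" y] by (simp add: add.assoc[symmetric])
    qed
    have gram: "ip (?adj (A (g + p)) y) (?adj (A (g + q)) z) = ip (?adj (A p) y) (?adj (A q) z)"
      and gram_\<Psi>: "ip (?adj (\<Psi> (g + p)) y) (?adj (A (g + q)) z) = ip (?adj (\<Psi> p) y) (?adj (A q) z)"
      for g p q y z
      using R by (simp_all add: ip_hadjoint_hadjoint[OF H H0 bA] del: comp_apply)
    \<comment> \<open>The two families are indexed by pairs of a group element and a vector of the
      target space; both are total, the second by reindexing.\<close>
    have "\<exists>U. unitary_operator scale ip U \<and>
        (\<forall>i. U (case i of (p, y) \<Rightarrow> ?adj (A p) y) = (case i of (p, y) \<Rightarrow> ?adj (A (g + p)) y))" for g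
    proof (rule H.unitary_operator_exists)
      fix x assume "\<And>i. ip x (case i of (p, y) \<Rightarrow> ?adj (A p) y) = 0"
      from this[of "(p, y)" for p y] show "x = 0" by (intro total) simp
    next
      fix x assume "\<And>i. ip x (case i of (p, y) \<Rightarrow> ?adj (A (g + p)) y) = 0"
      from this[of "(p, y)" for p y] show "x = 0" by (intro total_shift[of x g]) simp
    qed (simp add: gram split: prod.split)
    then have "\<exists>U. unitary_operator scale ip U \<and> (\<forall>p y. U (?adj (A p) y) = ?adj (A (g + p)) y)" for g
      by simp
    then obtain \<pi> where U: "\<And>g. unitary_operator scale ip (\<pi> g)"
      and \<pi>A: "\<And>g p y. \<pi> g (?adj (A p) y) = ?adj (A (g + p)) y"
      by metis
    \<comment> \<open>Since \<open>\<pi> g\<close> was obtained from the \<open>A\<close>-vectors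
      alone, the difference is tested against the total family \<open>?adj (A (g + q)) z\<close>;
      unitarity and the mixed Gram relation make the two inner products agree.\<close>
    have \<pi>\<Psi>: "\<pi> g (?adj (\<Psi> p) y) = ?adj (\<Psi> (g + p)) y" for g p y
    proof -
      have "\<pi> g (?adj (\<Psi> p) y) - ?adj (\<Psi> (g + p)) y = 0"
      proof (rule total_shift[of _ g])
        fix q z
        have "ip (\<pi> g (?adj (\<Psi> p) y)) (?adj (A (g + q)) z)
            = ip (\<pi> g (?adj (\<Psi> p) y)) (\<pi> g (?adj (A q) z))" by (simp add: \<pi>A)
        also have "\<dots> = ip (?adj (\<Psi> p) y) (?adj (A q) z)" by (rule H.unitary_operator_ip[OF U])
        finally show "ip (\<pi> g (?adj (\<Psi> p) y) - ?adj (\<Psi> (g + p)) y) (?adj (A (g + q)) z) = 0"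
          by (simp add: H.ip_diff_left gram_\<Psi>)
      qed
      then show ?thesis by simp
    qed
    \<comment> \<open>Both sides send \<open>?adj (A q) y\<close> to the same vector by
      associativity, and these vectors determine the operator.\<close>
    have hom: "\<pi> (g + p) = \<pi> g \<circ> \<pi> p" for g p
    proof (rule H.unitary_operator_eqI[OF U, where u = "\<lambda>(q, y). ?adj (A q) y"])
      show "ip ((\<pi> g \<circ> \<pi> p) x) ((\<pi> g \<circ> \<pi> p) y) = ip x y" for x y
        by (simp add: H.unitary_operator_ip[OF U])
      show "(\<pi> g \<circ> \<pi> p) (case i of (q, y) \<Rightarrow> ?adj (A q) y)
          = \<pi> (g + p) (case i of (q, y) \<Rightarrow> ?adj (A q) y)" for i
        by (simp add: \<pi>A add.assoc split: prod.split)
      fix x assume "\<And>i. ip x (\<pi> (g + p) (case i of (q, y) \<Rightarrow> ?adj (A q) y)) = 0"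
      from this[of "(q, y)" for q y] show "x = 0"
        by (intro total_shift[of x "g + p"]) (simp add: \<pi>A)
    qed
    \<comment> \<open>Applying the unitary \<open>\<pi> (- g)\<close> to both arguments of the inner
      product carries \<open>?adj (B g) y\<close> to \<open>?adj (B 0) y\<close>; this serves
      \<open>A\<close> and \<open>\<Psi>\<close> alike.\<close>
    have factor: "B g = B 0 \<circ> \<pi> (- g)"
      if \<pi>B: "\<And>g p y. \<pi> g (?adj (B p) y) = ?adj (B (g + p)) y"
        and bB: "\<And>p. bounded_operator scale scale0 (B p)" for B :: "'g \<Rightarrow> 'h \<Rightarrow> 'h0" and g
    proof
      fix h
      show "B g h = (B 0 \<circ> \<pi> (- g)) h"
      proof (rule H0.ip_left_eqI)
        fix y
        have "ip0 (B g h) y = ip h (?adj (B g) y)" by (rule hadjoint_eq[OF H H0 bB])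
        also have "\<dots> = ip (\<pi> (- g) h) (\<pi> (- g) (?adj (B g) y))"
          by (rule H.unitary_operator_ip[OF U, symmetric])
        also have "\<dots> = ip0 (B 0 (\<pi> (- g) h)) y"
          by (simp add: \<pi>B hadjoint_eq[OF H H0 bB])
        finally show "ip0 (B g h) y = ip0 ((B 0 \<circ> \<pi> (- g)) h) y" by simp
      qed
    qed
    have "unitary_representation scale ip \<pi>"
      by (rule unitary_representationI_frame[OF H H0 haar frame U hom factor[OF \<pi>A bA]])
    then show ?L using factor[OF \<pi>A bA] factor[OF \<pi>\<Psi> b\<Psi>] by blast
  }
qed

end
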